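(* Let $(X,d,\mu,\mathcal E,\mathcal F)$ be a sub-Gaussian Dirichlet space with parameters $d_H,d_W$ that satisfies $wBE(\kappa)$ with $\kappa=d_W-\lambda_1^\#$. For $f\in L^1(X,\mu)$ with $f\ge0$ a.e., let $E_t(f)=\{x\in X: f(x)>t\}$. There are constants $C_1,C_2>0$ (independent of $f$) such that for every such $f$, $$C_1\int_0^\infty\mathbf{Var}(\mathbf 1_{E_t(f)})\,dt\le\mathbf{Var}(f)\le C_2\int_0^\infty\mathbf{Var}(\mathbf 1_{E_t(f)})\,dt.$$ In particular, if $f\in BV(X)$ then $\mathbf 1_{E_t(f)}\in BV(X)$ for almost every $t$. Conversely, if $\mathbf 1_{E_t(f)}\in BV(X)$ for almost every $t\ge0$ and $\int_0^\infty\mathbf{Var}(\mathbf 1_{E_t(f)})\,dt<\infty$, then $f\in BV(X)$.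
   Context: A sub-Gaussian Dirichlet space $(X,d,\mu,\mathcal E,\mathcal F)$ with parameters $d_H,d_W$ means: $(X,d,\mu)$ is a locally compact metric measure space, $\mu$ is a Radon measure with support $X$, $(\mathcal E,\mathcal F)$ is a Dirichlet form on $L^2(X,\mu)$, and (i) every ball $B(x,r)=\{y: d(x,y)<r\}$, $x\in X$, $0<r<\infty$, has compact closure; (ii) $\mu$ is Ahlfors $d_H$-regular: there are $c_1,c_2,d_H\in(0,\infty)$ with $c_1r^{d_H}\le\mu(B(x,r))\le c_2r^{d_H}$ for all $x\in X$, $r\in[0,\infty)$; (iii) $\mathcal E$ is regular and strongly local (i.e. $\mathcal E(u,v)=0$ for $u,v\in\mathcal F$ with compact supports such that $u$ is constant in a neighborhood of the support of $v$); (iv) the heat semigroup $\{P_t\}$ of $(\mathcal E,\mathcal F)$ has a continuous heat kernel $p_t(x,y)$ (so $P_tg(x)=\int_Xp_t(x,y)g(y)\,d\mu(y)$) satisfying, for some $c_3,c_4,c_5,c_6\in(0,\infty)$ and $d_W\in(2,\infty)$, $$c_5t^{-d_H/d_W}\exp\Big(-c_6\Big(\tfrac{d(x,y)^{d_W}}{t}\Big)^{\frac1{d_W-1}}\Big)\le p_t(x,y)\le c_3t^{-d_H/d_W}\exp\Big(-c_4\Big(\tfrac{d(x,y)^{d_W}}{t}\Big)^{\frac1{d_W-1}}\Big)$$ for $\mu\times\mu$-a.e. $(x,y)$ and all $t>0$. In this setting $P_t1=1$. $X$ satisfies $wBE(\kappa)$ if $0<\kappa<d_W$ and there is $C>0$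 such that $|P_tg(x)-P_tg(y)|\le C\frac{d(x,y)^\kappa}{t^{\kappa/d_W}}\|g\|_{L^\infty(X,\mu)}$ for all $t>0$, $g\in L^\infty(X,\mu)$, $x,y\in X$. Let $\Delta_r=\{(x,y)\in X\times X: d(x,y)<r\}$. For $\lambda>0$, $KS^{\lambda,1}(X)$ is the set of $f\in L^1(X,\mu)$ such that $\limsup_{r\to0^+}\iint_{\Delta_r}\frac{|f(y)-f(x)|}{r^\lambda\mu(B(x,r))}\,d\mu(y)\,d\mu(x)<\infty$. Set $\lambda_1^\#=\sup\{\lambda>0: KS^{\lambda,1}(X)\text{ contains non-constant functions}\}$, $BV(X)=KS^{\lambda_1^\#,1}(X)$, and for $f\in L^1(X,\mu)$ $$\mathbf{Var}(f)=\liminf_{r\to0^+}\iint_{\Delta_r}\frac{|f(y)-f(x)|}{r^{\lambda_1^\#}\mu(B(x,r))}\,d\mu(y)\,d\mu(x)\in[0,\infty].$$ *)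

theory Defs
  imports "HOL-Analysis.Analysis" "HOL-Probability.Essential_Supremum"
begin

text \<open>
  The space \<open>X\<close> is the type \<open>'a\<close>. Elements of \<open>L\<^sup>p(X, \<mu>)\<close> are represented by
  functions \<open>'a \<Rightarrow> real\<close>; equality in \<open>L\<^sup>p\<close> is equality almost everywhere.
\<close>

subsection \<open>Metric measure spaces\<close>

definition radon_measure :: "'a::topological_space measure \<Rightarrow> bool" where
  "radon_measure M \<longleftrightarrow>
     sets M = sets borel \<and>
     (\<forall>K. compact K \<longrightarrow> emeasure M K < \<infinity>) \<and>
     (\<forall>B\<in>sets borel. emeasure M B = (INF U\<in>{U. open U \<and> B \<subseteq> U}. emeasure M U)) \<and>
     (\<forall>U. open U \<longrightarrow> emeasure M U = (SUP K\<in>{K. compact K \<and> K \<subseteq> U}. emeasure M K))"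

definition full_support :: "'a::topological_space measure \<Rightarrow> bool" where
  "full_support M \<longleftrightarrow> (\<forall>U. open U \<and> U \<noteq> {} \<longrightarrow> emeasure M U > 0)"

definition ahlfors_regular :: "'a::metric_space measure \<Rightarrow> real \<Rightarrow> bool" where
  "ahlfors_regular M d\<^sub>H \<longleftrightarrow> 0 < d\<^sub>H \<and>
     (\<exists>c1>0. \<exists>c2>0. \<forall>x. \<forall>r\<ge>0.
        ennreal (c1 * r powr d\<^sub>H) \<le> emeasure M (ball x r) \<and>
        emeasure M (ball x r) \<le> ennreal (c2 * r powr d\<^sub>H))"

subsection \<open>Function spaces\<close>

definition L2 :: "'a measure \<Rightarrow> ('a \<Rightarrow> real) set" where
  "L2 M = {u \<in> borel_measurable M. integrable M (\<lambda>x. (u x)\<^sup>2)}"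

definition L2_norm :: "'a measure \<Rightarrow> ('a \<Rightarrow> real) \<Rightarrow> real" where
  "L2_norm M u = sqrt (\<integral>x. (u x)\<^sup>2 \<partial>M)"

definition L2_inner :: "'a measure \<Rightarrow> ('a \<Rightarrow> real) \<Rightarrow> ('a \<Rightarrow> real) \<Rightarrow> real" where
  "L2_inner M u v = (\<integral>x. u x * v x \<partial>M)"

definition Linf :: "'a measure \<Rightarrow> ('a \<Rightarrow> real) set" where
  "Linf M = {g \<in> borel_measurable M. esssup M (\<lambda>x. ereal \<bar>g x\<bar>) < \<infinity>}"

definition Linf_norm :: "'a measure \<Rightarrow> ('a \<Rightarrow> real) \<Rightarrow> real" where
  "Linf_norm M g = real_of_ereal (esssup M (\<lambda>x. ereal \<bar>g x\<bar>))"

definition ess_support :: "'a::topological_space measure \<Rightarrow> ('a \<Rightarrow> real) \<Rightarrow> 'a set" where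
  "ess_support M u = - \<Union>{U. open U \<and> (AE x in M. x \<in> U \<longrightarrow> u x = 0)}"

definition Cc :: "('a::topological_space \<Rightarrow> real) set" where
  "Cc = {u. continuous_on UNIV u \<and> compact (closure {x. u x \<noteq> 0})}"

subsection \<open>Dirichlet forms\<close>

text \<open>The domain \<open>F\<close> contains all representatives of each of its \<open>L\<^sup>2\<close>-classes.\<close>

definition E1_norm :: "'a measure \<Rightarrow> (('a \<Rightarrow> real) \<Rightarrow> ('a \<Rightarrow> real) \<Rightarrow> real) \<Rightarrow> ('a \<Rightarrow> real) \<Rightarrow> real" where
  "E1_norm M E u = sqrt (E u u + L2_inner M u u)"

locale dirichlet_form =
  fixes M :: "'a measure"
    and E :: "('a \<Rightarrow> real) \<Rightarrow> ('a \<Rightarrow> real) \<Rightarrow> real"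
    and F :: "('a \<Rightarrow> real) set"
  assumes dom_L2: "F \<subseteq> L2 M"
    and dom_zero: "(\<lambda>x. 0) \<in> F"
    and dom_lin: "\<lbrakk>u \<in> F; v \<in> F\<rbrakk> \<Longrightarrow> (\<lambda>x. a * u x + b * v x) \<in> F"
    and dom_AE: "\<lbrakk>u \<in> F; v \<in> borel_measurable M; AE x in M. u x = v x\<rbrakk> \<Longrightarrow> v \<in> F"
    and dom_dense: "\<lbrakk>u \<in> L2 M; 0 < \<epsilon>\<rbrakk> \<Longrightarrow> \<exists>v\<in>F. L2_norm M (\<lambda>x. u x - v x) < \<epsilon>"
    and form_AE: "\<lbrakk>u \<in> F; v \<in> F; w \<in> F; AE x in M. u x = v x\<rbrakk> \<Longrightarrow> E u w = E v w"
    and form_lin: "\<lbrakk>u \<in> F; v \<in> F; w \<in> F\<rbrakk> \<Longrightarrow> E (\<lambda>x. a * u x + b * v x) w = a * E u w + b * E v w"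
    and form_sym: "\<lbrakk>u \<in> F; v \<in> F\<rbrakk> \<Longrightarrow> E u v = E v u"
    and form_nonneg: "u \<in> F \<Longrightarrow> 0 \<le> E u u"
    and closed: "\<lbrakk>\<And>n. s n \<in> F;
        \<And>\<epsilon>. 0 < \<epsilon> \<Longrightarrow> \<exists>N. \<forall>m\<ge>N. \<forall>n\<ge>N. E1_norm M E (\<lambda>x. s m x - s n x) < \<epsilon>\<rbrakk>
        \<Longrightarrow> \<exists>u\<in>F. (\<lambda>n. E1_norm M E (\<lambda>x. s n x - u x)) \<longlonglongrightarrow> 0"
    and markov_dom: "u \<in> F \<Longrightarrow> (\<lambda>x. min 1 (max 0 (u x))) \<in> F"
    and markov: "u \<in> F \<Longrightarrow> E (\<lambda>x. min 1 (max 0 (u x))) (\<lambda>x. min 1 (max 0 (u x))) \<le> E u u"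

definition regular_form ::
  "'a::topological_space measure \<Rightarrow> (('a \<Rightarrow> real) \<Rightarrow> ('a \<Rightarrow> real) \<Rightarrow> real) \<Rightarrow> ('a \<Rightarrow> real) set \<Rightarrow> bool" where
  "regular_form M E F \<longleftrightarrow>
     (\<forall>u\<in>F. \<forall>\<epsilon>>0. \<exists>v\<in>F \<inter> Cc. E1_norm M E (\<lambda>x. u x - v x) < \<epsilon>) \<and>
     (\<forall>u\<in>Cc. \<forall>\<epsilon>>0. \<exists>v\<in>F \<inter> Cc. \<forall>x. \<bar>u x - v x\<bar> < \<epsilon>)"

definition strongly_local ::
  "'a::topological_space measure \<Rightarrow> (('a \<Rightarrow> real) \<Rightarrow> ('a \<Rightarrow> real) \<Rightarrow> real) \<Rightarrow> ('a \<Rightarrow> real) set \<Rightarrow> bool" where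
  "strongly_local M E F \<longleftrightarrow>
     (\<forall>u\<in>F. \<forall>v\<in>F. compact (ess_support M u) \<and> compact (ess_support M v) \<and>
        (\<exists>U c. open U \<and> ess_support M v \<subseteq> U \<and> (AE x in M. x \<in> U \<longrightarrow> u x = c))
        \<longrightarrow> E u v = 0)"

text \<open>\<open>Lu = h\<close>, where \<open>L\<close> is the self-adjoint operator with \<open>\<E>(u, v) = - \<langle>Lu, v\<rangle>\<close>.\<close>

definition form_generator ::
  "'a measure \<Rightarrow> (('a \<Rightarrow> real) \<Rightarrow> ('a \<Rightarrow> real) \<Rightarrow> real) \<Rightarrow> ('a \<Rightarrow> real) set
    \<Rightarrow> ('a \<Rightarrow> real) \<Rightarrow> ('a \<Rightarrow> real) \<Rightarrow> bool" where
  "form_generator M E F u h \<longleftrightarrow> u \<in> F \<and> h \<in> L2 M \<and> (\<forall>v\<in>F. E u v = - L2_inner M h v)"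

text \<open>
  The heat semigroup \<open>P\<^sub>t = e\<^bsup>tL\<^esup>\<close>: the strongly continuous symmetric contraction semigroup
  on \<open>L\<^sup>2\<close> whose infinitesimal generator is \<open>L\<close>. By the Hille--Yosida theorem this determines
  \<open>P\<close> on \<open>L\<^sup>2\<close> up to almost everywhere equality.
\<close>

locale heat_semigroup =
  fixes M :: "'a measure"
    and E :: "('a \<Rightarrow> real) \<Rightarrow> ('a \<Rightarrow> real) \<Rightarrow> real"
    and F :: "('a \<Rightarrow> real) set"
    and P :: "real \<Rightarrow> ('a \<Rightarrow> real) \<Rightarrow> 'a \<Rightarrow> real"
  assumes P_L2: "\<lbrakk>0 \<le> t; u \<in> L2 M\<rbrakk> \<Longrightarrow> P t u \<in> L2 M"
    and P_lin: "\<lbrakk>0 \<le> t; u \<in> L2 M; v \<in> L2 M\<rbrakk>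
        \<Longrightarrow> AE x in M. P t (\<lambda>x. a * u x + b * v x) x = a * P t u x + b * P t v x"
    and P_contr: "\<lbrakk>0 \<le> t; u \<in> L2 M\<rbrakk> \<Longrightarrow> L2_norm M (P t u) \<le> L2_norm M u"
    and P_sym: "\<lbrakk>0 \<le> t; u \<in> L2 M; v \<in> L2 M\<rbrakk> \<Longrightarrow> L2_inner M (P t u) v = L2_inner M u (P t v)"
    and P_zero: "u \<in> L2 M \<Longrightarrow> AE x in M. P 0 u x = u x"
    and P_add: "\<lbrakk>0 \<le> s; 0 \<le> t; u \<in> L2 M\<rbrakk> \<Longrightarrow> AE x in M. P (s + t) u x = P s (P t u) x"
    and P_cont: "u \<in> L2 M \<Longrightarrow> ((\<lambda>t. L2_norm M (\<lambda>x. P t u x - u x)) \<longlongrightarrow> 0) (at_right 0)"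
    and P_gen: "\<lbrakk>u \<in> L2 M; h \<in> L2 M\<rbrakk> \<Longrightarrow>
        ((\<lambda>t. L2_norm M (\<lambda>x. (P t u x - u x) / t - h x)) \<longlongrightarrow> 0) (at_right 0)
          \<longleftrightarrow> form_generator M E F u h"

text \<open>
  \<open>p\<close> is a continuous heat kernel of the form: each \<open>p\<^sub>t\<close>, \<open>t > 0\<close>, is continuous on
  \<open>X \<times> X\<close> and is an integral kernel of \<open>P\<^sub>t\<close> on \<open>L\<^sup>2\<close>.
\<close>

definition continuous_heat_kernel ::
  "'a::topological_space measure \<Rightarrow> (('a \<Rightarrow> real) \<Rightarrow> ('a \<Rightarrow> real) \<Rightarrow> real) \<Rightarrow> ('a \<Rightarrow> real) set
    \<Rightarrow> (real \<Rightarrow> 'a \<Rightarrow> 'a \<Rightarrow> real) \<Rightarrow> bool" where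
  "continuous_heat_kernel M E F p \<longleftrightarrow>
     (\<forall>t>0. continuous_on UNIV (\<lambda>(x, y). p t x y)) \<and>
     (\<exists>P. heat_semigroup M E F P \<and>
        (\<forall>t>0. \<forall>g\<in>L2 M. AE x in M. has_bochner_integral M (\<lambda>y. p t x y * g y) (P t g x)))"

definition sub_gaussian_bounds ::
  "'a::metric_space measure \<Rightarrow> (real \<Rightarrow> 'a \<Rightarrow> 'a \<Rightarrow> real) \<Rightarrow> real \<Rightarrow> real \<Rightarrow> bool" where
  "sub_gaussian_bounds M p d\<^sub>H d\<^sub>W \<longleftrightarrow>
     (\<exists>c3>0. \<exists>c4>0. \<exists>c5>0. \<exists>c6>0. AE (x, y) in M \<Otimes>\<^sub>M M. \<forall>t>0.
        c5 * t powr (- d\<^sub>H / d\<^sub>W) * exp (- c6 * (dist x y powr d\<^sub>W / t) powr (1 / (d\<^sub>W - 1))) \<le> p t x y \<and>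
        p t x y \<le> c3 * t powr (- d\<^sub>H / d\<^sub>W) * exp (- c4 * (dist x y powr d\<^sub>W / t) powr (1 / (d\<^sub>W - 1))))"

text \<open>
  The heat kernel \<open>p\<close> is an explicit parameter; by its continuity and the full support of the
  measure it is determined by the form.
\<close>

locale sub_gaussian_dirichlet_space = dirichlet_form M E F
  for M :: "'a::metric_space measure" and E F +
  fixes p :: "real \<Rightarrow> 'a \<Rightarrow> 'a \<Rightarrow> real"
    and d\<^sub>H d\<^sub>W :: real
  assumes locally_compact: "locally_compact_space (euclidean :: 'a topology)"
    and radon: "radon_measure M"
    and support: "full_support M"
    and compact_balls: "0 < r \<Longrightarrow> compact (closure (ball (x :: 'a) r))"
    and ahlfors: "ahlfors_regular M d\<^sub>H"
    and regular: "regular_form M E F"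
    and local: "strongly_local M E F"
    and walk_dim: "2 < d\<^sub>W"
    and kernel: "continuous_heat_kernel M E F p"
    and bounds: "sub_gaussian_bounds M p d\<^sub>H d\<^sub>W"

definition heat_op ::
  "'a measure \<Rightarrow> (real \<Rightarrow> 'a \<Rightarrow> 'a \<Rightarrow> real) \<Rightarrow> real \<Rightarrow> ('a \<Rightarrow> real) \<Rightarrow> 'a \<Rightarrow> real" where
  "heat_op M p t g x = (\<integral>y. p t x y * g y \<partial>M)"

definition wBE ::
  "'a::metric_space measure \<Rightarrow> (real \<Rightarrow> 'a \<Rightarrow> 'a \<Rightarrow> real) \<Rightarrow> real \<Rightarrow> real \<Rightarrow> bool" where
  "wBE M p d\<^sub>W \<kappa> \<longleftrightarrow> 0 < \<kappa> \<and> \<kappa> < d\<^sub>W \<and>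
     (\<exists>C>0. \<forall>t>0. \<forall>g\<in>Linf M. \<forall>x y.
        \<bar>heat_op M p t g x - heat_op M p t g y\<bar>
          \<le> C * (dist x y powr \<kappa> / t powr (\<kappa> / d\<^sub>W)) * Linf_norm M g)"

subsection \<open>Korevaar--Schoen spaces and functions of bounded variation\<close>

definition KS_energy :: "'a::metric_space measure \<Rightarrow> real \<Rightarrow> ('a \<Rightarrow> real) \<Rightarrow> real \<Rightarrow> ennreal" where
  "KS_energy M l f r =
     (\<integral>\<^sup>+x. (\<integral>\<^sup>+y\<in>ball x r. ennreal (\<bar>f y - f x\<bar> / (r powr l * measure M (ball x r))) \<partial>M) \<partial>M)"

definition KS :: "'a::metric_space measure \<Rightarrow> real \<Rightarrow> ('a \<Rightarrow> real) set" where
  "KS M l = {f. integrable M f \<and> Limsup (at_right 0) (KS_energy M l f) < \<infinity>}"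

text \<open>The supremum is taken in the extended reals, so that it is \<open>\<infinity>\<close> if the set is unbounded.\<close>

definition crit_exp :: "'a::metric_space measure \<Rightarrow> ereal" where
  "crit_exp M = Sup {ereal l | l. 0 < l \<and> (\<exists>f\<in>KS M l. \<not> (\<exists>c. AE x in M. f x = c))}"

text \<open>The following two are meaningful when \<open>crit_exp M\<close> is finite.\<close>

definition BV :: "'a::metric_space measure \<Rightarrow> ('a \<Rightarrow> real) set" where
  "BV M = KS M (real_of_ereal (crit_exp M))"

definition Var :: "'a::metric_space measure \<Rightarrow> ('a \<Rightarrow> real) \<Rightarrow> ennreal" where
  "Var M f = Liminf (at_right 0) (KS_energy M (real_of_ereal (crit_exp M)) f)"

definition superlevel :: "('a \<Rightarrow> real) \<Rightarrow> real \<Rightarrow> 'a set" where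
  "superlevel f t = {x. f x > t}"

end

theory Submission
  imports Defs "HOL-Real_Asymp.Real_Asymp"
begin

text \<open>
  Put \<open>\<lambda> = d\<^sub>W - \<kappa>\<close> and let \<open>e\<^sub>r(f)\<close> be the Korevaar--Schoen energy at scale \<open>r\<close> with exponent
  \<open>\<lambda>\<close>. Integrating \<open>\<bar>f(y) - f(x)\<bar> = \<integral> \<bar>1\<^bsub>E\<^esub>(y) - 1\<^bsub>E\<^esub>(x)\<bar> dt\<close>, \<open>E = E\<^sub>t(f)\<close>, gives the coarea formula
  \<open>e\<^sub>r(f) = \<integral> e\<^sub>r(1\<^bsub>E\<^esub>) dt\<close> at every fixed scale, so all claims follow from Fatou's lemma once
  \<open>e\<^sub>r(1\<^bsub>E\<^esub>) \<le> C e\<^sub>\<rho>(1\<^bsub>E\<^esub>)\<close> for all sets \<open>E\<close> of finite measure and all small \<open>\<rho>\<close>.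

  For such \<open>E\<close> let \<open>h(t) = \<integral>\<integral> p\<^sub>t(x, y) \<bar>1\<^bsub>E\<^esub>(x) - 1\<^bsub>E\<^esub>(y)\<bar>\<close>. As \<open>P\<^sub>t 1 = 1\<close>, this is the \<open>L\<^sup>1\<close>-norm of
  \<open>P\<^sub>t 1\<^bsub>E\<^esub> - 1\<^bsub>E\<^esub>\<close>, hence subadditive in \<open>t\<close>. The kernel bounds and subadditivity make \<open>h(t)\<close>
  comparable to \<open>r\<^sup>\<lambda> e\<^sub>r(1\<^bsub>E\<^esub>)\<close> for \<open>r\<close> of order \<open>t\<^bsup>1/d_W\<^esup>\<close>. Testing \<open>P\<^sub>s 1\<^bsub>E\<^esub> - P\<^bsub>s+t\<^esub> 1\<^bsub>E\<^esub>\<close>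
  against bounded functions \<open>g\<close>, moving \<open>P\<^sub>s\<close> to \<open>g\<close> and using the weak Bakry--Emery bound on
  \<open>P\<^sub>s g\<close> shows that its \<open>L\<^sup>1\<close>-norm is at most \<open>C (t/s)\<^bsup>\<kappa>/d_W\<^esup> h(t)\<close>. Summing over
  \<open>s = t, 2t, \<dots>\<close> yields \<open>h(n t) \<le> C n\<^bsup>\<lambda>/d_W\<^esup> h(t)\<close>, which is the required comparison of scales.
\<close>

subsection \<open>Preliminaries\<close>

text \<open>Raise \<open>z \<le> exp z\<close> at \<open>z = c * w / a\<close> to the power
  \<open>a\<close>. The explicit constant lets \<open>kernel_moment\<close> absorb a power of the
  distance into an exponential factor.\<close>

lemma powr_le_exp:
  fixes w :: real
  assumes "0 < a" "0 < c" "0 \<le> w"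
  shows "w powr a \<le> (a / c) powr a * exp (c * w)"
proof -
  have "(c * w / a) powr a \<le> exp (c * w / a) powr a"
    using assms exp_ge_add_one_self[of "c * w / a"]
    by (intro powr_mono2) (auto simp del: exp_ge_add_one_self)
  also have "\<dots> = exp (c * w)" using assms by (simp add: powr_def)
  finally have "(a / c) powr a * (c * w / a) powr a \<le> (a / c) powr a * exp (c * w)"
    by (rule mult_left_mono) simp
  moreover have "(a / c) powr a * (c * w / a) powr a = w powr a"
    using assms by (simp flip: powr_mult)
  ultimately show ?thesis by simp
qed

lemma open_prod_rect:
  "open W \<Longrightarrow> (x, y) \<in> W \<Longrightarrow> \<exists>U V. open U \<and> open V \<and> x \<in> U \<and> y \<in> V \<and> U \<times> V \<subseteq> W"
  by (metis open_prod_elim mem_Sigma_iff)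

text \<open>The mean value theorem gives a point \<open>z\<close> below \<open>2 * x\<close>, and
  passing from \<open>2 * x\<close> to \<open>x\<close> costs at most a factor one half because
  \<open>b - 1 > - 1\<close>. This closes the induction in \<open>heat_energy_scaling\<close>, where
  terms of size \<open>x powr (b - 1)\<close> are summed.\<close>

lemma powr_increment_lower:
  fixes x b :: real
  assumes "1 \<le> x" "0 < b" "b < 1"
  shows "b / 2 * x powr (b - 1) \<le> (x + 1) powr b - x powr b"
proof -
  obtain z where z: "x < z" "z < x + 1" "(x + 1) powr b - x powr b = (x + 1 - x) * (b * z powr (b - 1))"
  proof -
    have "\<exists>z>x. z < x + 1 \<and> (x + 1) powr b - x powr b = (x + 1 - x) * (b * z powr (b - 1))"
      using assms by (intro MVT2) (auto intro!: derivative_eq_intros)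
    then show thesis using that by blast
  qed
  have "x powr (b - 1) / 2 \<le> (2 * x) powr (b - 1)"
  proof -
    have "2 powr (- 1) \<le> (2::real) powr (b - 1)" using assms by (intro powr_mono) auto
    then have "1 / 2 * x powr (b - 1) \<le> 2 powr (b - 1) * x powr (b - 1)"
      by (intro mult_right_mono) (auto simp: powr_minus)
    then show ?thesis using assms by (simp add: powr_mult)
  qed
  also have "\<dots> \<le> z powr (b - 1)" using z assms by (intro powr_mono2') auto
  finally show ?thesis using z assms by simp
qed

lemma ennreal_le_cmult_iff:
  assumes "0 < c"
  shows "a \<le> ennreal c * b \<longleftrightarrow> ennreal (1 / c) * a \<le> b"
proof -
  have 1: "ennreal (1 / c) * (ennreal c * b) = b" "ennreal c * (ennreal (1 / c) * a) = a"
    using assms by (simp_all flip: mult.assoc ennreal_mult')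
  show ?thesis using 1 mult_left_mono by (metis zero_le)
qed

lemma filterlim_inverse_Suc_at_right: "filterlim (\<lambda>n. 1 / real (Suc n)) (at_right 0) sequentially"
  using LIMSEQ_inverse_real_of_nat
  by (auto simp: filterlim_at inverse_eq_divide)

text \<open>Fatou's lemma applies to sequences, whereas \<open>Var\<close> is a lower limit over a
  continuous parameter; this passes from one to the other.\<close>

lemma Liminf_le_liminf_subseq:
  fixes g :: "'a \<Rightarrow> 'b::complete_linorder"
  assumes "filterlim s F sequentially"
  shows "Liminf F g \<le> liminf (\<lambda>n. g (s n))"
  unfolding le_Liminf_iff
proof (intro allI impI)
  fix y assume "y < Liminf F g"
  then have "\<forall>\<^sub>F x in F. y < g x" by (rule less_LiminfD)
  then show "\<forall>\<^sub>F n in sequentially. y < g (s n)" using assms by (rule eventually_compose_filterlim)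
qed

section \<open>Separability of proper metric spaces and measurability on the product\<close>

text \<open>Balls with compact closure are totally bounded, so the finite nets \<open>k n m\<close>
  of finer and finer mesh for larger and larger balls around one point have a countable dense
  union.\<close>

lemma proper_imp_countable_dense:
  assumes "\<And>x r. 0 < r \<Longrightarrow> compact (closure (ball (x::'a::metric_space) r))"
  obtains D :: "'a::metric_space set" where "countable D" "\<And>x e. 0 < e \<Longrightarrow> \<exists>a\<in>D. dist a x < e"
proof -
  fix x0 :: 'a
  have "\<exists>k. finite k \<and> closure (ball x0 (real (Suc n))) \<subseteq> (\<Union>x\<in>k. ball x (1 / real (Suc m)))" for n m
    using assms[of "real (Suc n)" x0]
    unfolding compact_eq_totally_bounded by (metis of_nat_0_less_iff zero_less_Suc zero_less_divide_1_iff)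
  then obtain k where k: "\<And>n m. finite (k n m)"
    "\<And>n m. closure (ball x0 (real (Suc n))) \<subseteq> (\<Union>x\<in>k n m. ball x (1 / real (Suc m)))"
    by metis
  show thesis
  proof (rule that)
    show "countable (\<Union>n m. k n m)" using k(1) by (intro countable_UN) (auto intro: countable_finite)
    fix x :: 'a and e :: real assume "0 < e"
    obtain m where m: "1 / real (Suc m) < e" using \<open>0 < e\<close> nat_approx_posE by auto
    obtain n where "dist x0 x < real n" using reals_Archimedean2 by blast
    then have "x \<in> closure (ball x0 (real (Suc n)))"
      by (intro subsetD[OF closure_subset]) auto
    then obtain a where "a \<in> k n m" "dist a x < 1 / real (Suc m)" using k(2)[of n m] by auto
    then show "\<exists>a\<in>\<Union>n m. k n m. dist a x < e" using m by (intro bexI[of _ a]) auto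
  qed
qed

text \<open>By separability an open set of the product is a countable union of products of balls
  with centres in \<open>D\<close> and radii \<open>1 / real (Suc n)\<close>. Hence continuous
  functions of two points, such as the distance and the heat kernel, are measurable for the product
  sigma-algebra.\<close>

lemma open_in_sets_pair_borel:
  fixes W :: "('a::metric_space \<times> 'a) set"
  assumes proper: "\<And>x r. 0 < r \<Longrightarrow> compact (closure (ball (x::'a) r))"
    and "open W"
  shows "W \<in> sets (borel \<Otimes>\<^sub>M borel)"
proof -
  obtain D :: "'a set" where D: "countable D" "\<And>x e. 0 < e \<Longrightarrow> \<exists>a\<in>D. dist a x < e"
    using proper_imp_countable_dense[OF proper] by blast
  define B where "B = (\<lambda>(a::'a, b::'a, n). ball a (1 / real (Suc n)) \<times> ball b (1 / real (Suc n)))"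
  define I where "I = {i \<in> D \<times> D \<times> UNIV. B i \<subseteq> W}"
  have "countable I"
    unfolding I_def using D(1) by (intro countable_Collect countable_SIGMA) auto
  moreover have "W = (\<Union>i\<in>I. B i)"
  proof
    show "W \<subseteq> (\<Union>i\<in>I. B i)"
    proof (clarify)
      fix x y assume "(x, y) \<in> W"
      then obtain U V where UV: "open U" "open V" "x \<in> U" "y \<in> V" "U \<times> V \<subseteq> W"
        using open_prod_elim[OF \<open>open W\<close>] by (metis mem_Sigma_iff)
      obtain e1 where e1: "e1 > 0" "ball x e1 \<subseteq> U" using UV openE by meson
      obtain e2 where e2: "e2 > 0" "ball y e2 \<subseteq> V" using UV openE by meson
      \<comment> \<open>The half leaves room for moving the centres from \<open>x\<close> and
        \<open>y\<close> to nearby points \<open>a\<close> and \<open>b\<close> of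
        \<open>D\<close>.\<close>
      obtain n where n: "1 / real (Suc n) < min e1 e2 / 2"
        using nat_approx_posE[of "min e1 e2 / 2"] e1(1) e2(1) by auto
      obtain a where a: "a \<in> D" "dist a x < 1 / real (Suc n)"
        using D(2)[of "1 / real (Suc n)"] by auto
      obtain b where b: "b \<in> D" "dist b y < 1 / real (Suc n)"
        using D(2)[of "1 / real (Suc n)"] by auto
      have "ball a (1 / real (Suc n)) \<subseteq> ball x e1"
      proof
        fix z assume "z \<in> ball a (1 / real (Suc n))"
        then show "z \<in> ball x e1" using a n dist_triangle[of x z a] by (simp add: dist_commute)
      qed
      moreover have "ball b (1 / real (Suc n)) \<subseteq> ball y e2"
      proof
        fix z assume "z \<in> ball b (1 / real (Suc n))"
        then show "z \<in> ball y e2" using b n dist_triangle[of y z b] by (simp add: dist_commute)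
      qed
      ultimately have "B (a, b, n) \<subseteq> U \<times> V" unfolding B_def using e1(2) e2(2)
        by (simp only: prod.case) (intro Sigma_mono; blast)
      then have "B (a, b, n) \<subseteq> W" using UV(5) by blast
      then have "(a, b, n) \<in> I" unfolding I_def using a b by auto
      moreover have "(x, y) \<in> B (a, b, n)" using a b unfolding B_def by (auto simp: dist_commute)
      ultimately show "(x, y) \<in> (\<Union>i\<in>I. B i)" by blast
    qed
  qed (auto simp: I_def)
  moreover have "B i \<in> sets (borel \<Otimes>\<^sub>M borel)" for i
    unfolding B_def by (cases i) auto
  ultimately show ?thesis by auto
qed

lemma continuous_imp_measurable_pair_borel:
  fixes g :: "'a::metric_space \<times> 'a \<Rightarrow> 'b::topological_space"
  assumes "\<And>x r. 0 < r \<Longrightarrow> compact (closure (ball (x::'a) r))"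
    and "continuous_on UNIV g"
  shows "g \<in> borel_measurable (borel \<Otimes>\<^sub>M borel)"
proof (rule borel_measurableI)
  fix S :: "'b set" assume "open S"
  then have "open (g -` S)" using assms(2) by (simp add: continuous_on_open_vimage)
  then show "g -` S \<inter> space (borel \<Otimes>\<^sub>M borel) \<in> sets (borel \<Otimes>\<^sub>M borel)"
    using open_in_sets_pair_borel[OF assms(1)] by (simp add: space_pair_measure)
qed

subsection \<open>Symmetric Markov kernels\<close>

text \<open>Models the heat kernel at one fixed time. The unit mass is a nonnegative integral, so
  that it also carries the integrability of \<open>k x\<close>.\<close>

locale symmetric_markov_kernel = sigma_finite_measure M for M :: "'a measure" +
  fixes k :: "'a \<Rightarrow> 'a \<Rightarrow> real"
  assumes kernel_measurable: "(\<lambda>(x, y). k x y) \<in> borel_measurable (M \<Otimes>\<^sub>M M)"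
    and kernel_nonneg: "0 \<le> k x y"
    and kernel_sym: "k x y = k y x"
    and kernel_total: "x \<in> space M \<Longrightarrow> (\<integral>\<^sup>+y. ennreal (k x y) \<partial>M) = 1"
begin

sublocale pair_sigma_finite M M ..

abbreviation K :: "('a \<Rightarrow> real) \<Rightarrow> 'a \<Rightarrow> real" where
  "K w x \<equiv> (\<integral>y. k x y * w y \<partial>M)"

lemma kernel_measurable' [measurable (raw)]:
  assumes [measurable]: "f \<in> N \<rightarrow>\<^sub>M M" "g \<in> N \<rightarrow>\<^sub>M M"
  shows "(\<lambda>z. k (f z) (g z)) \<in> borel_measurable N"
  using measurable_compose[OF measurable_Pair[OF assms] kernel_measurable] by simp

lemma integrable_kernel: "x \<in> space M \<Longrightarrow> integrable M (k x)"
  using kernel_total[of x] kernel_nonneg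
  by (intro integrableI_nonneg) auto

lemma integral_kernel: "x \<in> space M \<Longrightarrow> (\<integral>y. k x y \<partial>M) = 1"
  using kernel_total[of x] integrable_kernel[of x] kernel_nonneg
  by (simp add: integral_eq_nn_integral)

lemma integrable_kernel_snd:
  assumes "integrable M w" and [measurable]: "v \<in> borel_measurable M"
    and "\<And>x. \<bar>v x\<bar> \<le> B"
  shows "integrable (M \<Otimes>\<^sub>M M) (\<lambda>(x, y). k x y * w y * v x)"
proof -
  have [measurable]: "w \<in> borel_measurable M" using assms(1) by auto
  have "(\<integral>\<^sup>+z. ennreal (norm (case z of (x, y) \<Rightarrow> k x y * w y)) \<partial>(M \<Otimes>\<^sub>M M))
      = (\<integral>\<^sup>+y. \<integral>\<^sup>+x. ennreal (k y x) * ennreal \<bar>w y\<bar> \<partial>M \<partial>M)"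
    by (subst nn_integral_snd[symmetric])
       (auto simp: abs_mult kernel_nonneg ennreal_mult' kernel_sym case_prod_beta
         intro!: nn_integral_cong)
  also have "\<dots> = (\<integral>\<^sup>+y. ennreal \<bar>w y\<bar> \<partial>M)"
    by (intro nn_integral_cong) (simp add: nn_integral_multc kernel_total)
  also have "\<dots> < \<infinity>" using assms(1) by (auto simp: integrable_iff_bounded)
  finally have "integrable (M \<Otimes>\<^sub>M M) (\<lambda>(x, y). k x y * w y)"
    by (intro integrableI_bounded) (auto simp: case_prod_beta)
  then have "integrable (M \<Otimes>\<^sub>M M) (\<lambda>z. B * (case z of (x, y) \<Rightarrow> k x y * w y))"
    by (rule integrable_mult_right)
  then show ?thesis
  proof (rule Bochner_Integration.integrable_bound)
    show "AE z in M \<Otimes>\<^sub>M M. norm (case z of (x, y) \<Rightarrow> k x y * w y * v x)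
        \<le> norm (B * (case z of (x, y) \<Rightarrow> k x y * w y))"
    proof (rule AE_I2, clarify)
      fix x y
      have "\<bar>k x y * w y\<bar> * \<bar>v x\<bar> \<le> \<bar>k x y * w y\<bar> * \<bar>B\<bar>"
        using assms(3)[of x] by (intro mult_left_mono) auto
      then show "norm (k x y * w y * v x) \<le> norm (B * (k x y * w y))"
        by (simp add: abs_mult mult_ac)
    qed
  qed (simp add: case_prod_beta)
qed

lemma integrable_kernel_fst:
  assumes "integrable M w" and "v \<in> borel_measurable M" and "\<And>x. \<bar>v x\<bar> \<le> B"
  shows "integrable (M \<Otimes>\<^sub>M M) (\<lambda>(x, y). k x y * w x * v y)"
  using integrable_product_swap[OF integrable_kernel_snd[OF assms]]
  by (simp add: case_prod_beta kernel_sym)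

lemma integrable_kernel_op: "integrable M w \<Longrightarrow> integrable M (K w)"
  using integrable_fst[OF integrable_kernel_snd[of w "\<lambda>_. 1" 1]] by simp

lemma kernel_op_bound:
  assumes x: "x \<in> space M" and [measurable]: "w \<in> borel_measurable M" and B: "\<And>x. \<bar>w x\<bar> \<le> B"
  shows "\<bar>K w x\<bar> \<le> B"
proof -
  have le: "\<bar>k x y * w y\<bar> \<le> B * k x y" for y
    using mult_right_mono[OF B kernel_nonneg] by (simp add: abs_mult kernel_nonneg mult.commute)
  have i: "integrable M (\<lambda>y. k x y * w y)"
  proof (rule Bochner_Integration.integrable_bound[OF integrable_mult_right[OF integrable_kernel[OF x], of B]])
    show "AE y in M. norm (k x y * w y) \<le> norm (B * k x y)"
      using le order_trans[OF _ abs_ge_self] by (intro AE_I2) auto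
  qed (use x in measurable)
  have "\<bar>K w x\<bar> \<le> (\<integral>y. B * k x y \<partial>M)"
    using i integrable_kernel[OF x] le
    by (intro order_trans[OF integral_abs_bound] integral_mono) auto
  then show ?thesis using integral_kernel[OF x] by simp
qed

text \<open>Tonelli's theorem with unit mass in the first variable. Applied to the difference of an
  indicator and its heat flow it yields subadditivity of the heat energy.\<close>

lemma kernel_op_contraction:
  assumes "integrable M w"
  shows "(\<integral>\<^sup>+x. ennreal \<bar>K w x\<bar> \<partial>M) \<le> (\<integral>\<^sup>+x. ennreal \<bar>w x\<bar> \<partial>M)"
proof -
  have [measurable]: "w \<in> borel_measurable M" using assms(1) by auto
  have "(\<integral>\<^sup>+x. ennreal \<bar>K w x\<bar> \<partial>M) \<le> (\<integral>\<^sup>+x. \<integral>\<^sup>+y. ennreal (k y x) * ennreal \<bar>w y\<bar> \<partial>M \<partial>M)"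
  proof (rule nn_integral_mono)
    fix x
    \<comment> \<open>Where the integrand is not integrable the Bochner integral is \<open>0\<close>
      by convention, so the bound holds there as well.\<close>
    have "ennreal (norm (K w x)) \<le> (\<integral>\<^sup>+y. ennreal (norm (k x y * w y)) \<partial>M)"
      by (cases "integrable M (\<lambda>y. k x y * w y)")
         (simp_all add: not_integrable_integral_eq integral_norm_bound_ennreal del: real_norm_def)
    then show "ennreal \<bar>K w x\<bar> \<le> (\<integral>\<^sup>+y. ennreal (k y x) * ennreal \<bar>w y\<bar> \<partial>M)"
      by (simp add: abs_mult kernel_nonneg ennreal_mult' kernel_sym[of x])
  qed
  also have "\<dots> = (\<integral>\<^sup>+y. \<integral>\<^sup>+x. ennreal (k y x) * ennreal \<bar>w y\<bar> \<partial>M \<partial>M)"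
    by (rule Fubini') simp
  also have "\<dots> = (\<integral>\<^sup>+y. ennreal \<bar>w y\<bar> \<partial>M)"
    by (intro nn_integral_cong) (simp add: nn_integral_multc kernel_total)
  finally show ?thesis .
qed

lemma kernel_op_adjoint:
  assumes w: "integrable M w" and v: "v \<in> borel_measurable M" "\<And>x. \<bar>v x\<bar> \<le> B"
  shows "(\<integral>x. K w x * v x \<partial>M) = (\<integral>x. w x * K v x \<partial>M)"
proof -
  have "(\<integral>x. K w x * v x \<partial>M) = (\<integral>x. \<integral>y. k x y * w y * v x \<partial>M \<partial>M)"
    by (simp flip: integral_mult_left_zero)
  also have "\<dots> = (\<integral>y. \<integral>x. k x y * w y * v x \<partial>M \<partial>M)"
    using Fubini_integral[OF integrable_kernel_snd[OF assms]] by simp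
  also have "\<dots> = (\<integral>y. w y * K v y \<partial>M)"
    by (simp add: kernel_sym mult_ac flip: integral_mult_right_zero)
  finally show ?thesis .
qed

text \<open>Integration by parts: unit mass turns the left side into the integral of
  \<open>?\<phi> x y\<close>, and averaging with \<open>?\<phi> y x\<close>, which has the same
  integral, produces the difference of \<open>v\<close>. Only differences of \<open>v\<close> then
  enter, to which a Hoelder bound applies.\<close>

lemma kernel_op_green:
  assumes w: "integrable M w" and v[measurable]: "v \<in> borel_measurable M" "\<And>x. \<bar>v x\<bar> \<le> B"
  shows "(\<integral>x. (w x - K w x) * v x \<partial>M) =
    (\<integral>(x, y). k x y * (w x - w y) * (v x - v y) \<partial>(M \<Otimes>\<^sub>M M)) / 2"
    (is "?L = ?R / 2")
    and "integrable (M \<Otimes>\<^sub>M M) (\<lambda>(x, y). k x y * (w x - w y) * (v x - v y))" (is ?I)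
proof -
  have [measurable]: "w \<in> borel_measurable M" using w by auto
  let ?\<phi> = "\<lambda>x y. k x y * (w x - w y) * v x"
  have "integrable M (\<lambda>x. w x * v x)"
  proof (rule Bochner_Integration.integrable_bound[OF integrable_mult_left[OF w, of B]])
    show "AE x in M. norm (w x * v x) \<le> norm (w x * B)"
      by (intro AE_I2) (simp add: abs_mult mult_left_mono order_trans[OF v(2) abs_ge_self])
  qed measurable
  from integrable_kernel_fst[OF this, of "\<lambda>_. 1" 1]
  have wv: "integrable (M \<Otimes>\<^sub>M M) (\<lambda>(x, y). k x y * (w x * v x))" by simp
  have i: "integrable (M \<Otimes>\<^sub>M M) (\<lambda>(x, y). ?\<phi> x y)"
    using Bochner_Integration.integrable_diff[OF wv integrable_kernel_snd[OF assms]]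
    by (rule back_subst[where P = "integrable (M \<Otimes>\<^sub>M M)"]) (auto simp: fun_eq_iff algebra_simps)
  have i': "integrable (M \<Otimes>\<^sub>M M) (\<lambda>(x, y). ?\<phi> y x)"
    using integrable_product_swap[OF i] by (simp add: case_prod_beta)
  have e: "(\<lambda>(x, y). k x y * (w x - w y) * (v x - v y)) = (\<lambda>z. (\<lambda>(x, y). ?\<phi> x y) z + (\<lambda>(x, y). ?\<phi> y x) z)"
    by (auto simp: fun_eq_iff algebra_simps kernel_sym)
  show ?I unfolding e by (rule Bochner_Integration.integrable_add[OF i i'])
  have "?R = (\<integral>(x, y). ?\<phi> x y \<partial>(M \<Otimes>\<^sub>M M)) + (\<integral>(x, y). ?\<phi> y x \<partial>(M \<Otimes>\<^sub>M M))"
    unfolding e by (rule Bochner_Integration.integral_add[OF i i'])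
  also have "(\<integral>(x, y). ?\<phi> y x \<partial>(M \<Otimes>\<^sub>M M)) = (\<integral>(x, y). ?\<phi> x y \<partial>(M \<Otimes>\<^sub>M M))"
    using integral_product_swap[of "\<lambda>(x, y). ?\<phi> x y"] i by (simp add: case_prod_beta)
  also have "(\<integral>(x, y). ?\<phi> x y \<partial>(M \<Otimes>\<^sub>M M)) = (\<integral>x. \<integral>y. ?\<phi> x y \<partial>M \<partial>M)"
    using integral_fst'[OF i] by simp
  also have "\<dots> = ?L"
  proof (rule integral_cong_AE)
    show "AE x in M. (\<integral>y. ?\<phi> x y \<partial>M) = (w x - K w x) * v x"
      using AE_integrable_fst[OF integrable_kernel_snd[OF w borel_measurable_const[of 1], of 1, simplified]] AE_space
    proof eventually_elim
      case (elim x)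
      then have "x \<in> space M" and i: "integrable M (\<lambda>y. k x y * w y)" by auto
      have "(\<integral>y. k x y * (w x - w y) * v x \<partial>M) = (\<integral>y. (w x * k x y - k x y * w y) * v x \<partial>M)"
        by (simp add: algebra_simps)
      also have "\<dots> = (w x - K w x) * v x"
        using i integrable_kernel[OF \<open>x \<in> space M\<close>] integral_kernel[OF \<open>x \<in> space M\<close>] by simp
      finally show "(\<integral>y. ?\<phi> x y \<partial>M) = (w x - K w x) * v x" .
    qed
  qed measurable
  finally show "?L = ?R / 2" by simp
qed

text \<open>For fixed \<open>x\<close> the difference of the indicator values has the same sign for
  all \<open>y\<close>, so the absolute value moves inside the integral without loss. For general
  functions only one inequality would remain; this identity is the reason for working with sets
  first.\<close>

lemma nn_integral_indicator_minus_kernel_op: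
  assumes A[measurable]: "A \<in> sets M"
  shows "(\<integral>\<^sup>+x. ennreal \<bar>indicat_real A x - K (indicat_real A) x\<bar> \<partial>M) =
    (\<integral>\<^sup>+x. \<integral>\<^sup>+y. ennreal (k x y * \<bar>indicat_real A x - indicat_real A y\<bar>) \<partial>M \<partial>M)"
proof (rule nn_integral_cong)
  fix x assume x: "x \<in> space M"
  have i: "integrable M (\<lambda>y. k x y * indicat_real A y)"
    using integrable_mult_indicator[OF A integrable_kernel[OF x]] by (simp add: mult.commute)
  have j: "integrable M (\<lambda>y. k x y * (indicat_real A x - indicat_real A y))"
    using i integrable_kernel[OF x] by (simp add: algebra_simps)
  have ja: "integrable M (\<lambda>y. k x y * \<bar>indicat_real A x - indicat_real A y\<bar>)"
    using integrable_abs[OF j] by (simp add: abs_mult kernel_nonneg)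
  have *: "indicat_real A x - K (indicat_real A) x = (\<integral>y. k x y * (indicat_real A x - indicat_real A y) \<partial>M)"
    using i integrable_kernel[OF x] integral_kernel[OF x] by (simp add: algebra_simps)
  have "\<bar>\<integral>y. k x y * (indicat_real A x - indicat_real A y) \<partial>M\<bar> =
      (\<integral>y. k x y * \<bar>indicat_real A x - indicat_real A y\<bar> \<partial>M)"
  proof (cases "x \<in> A")
    case True
    then have "k x y * \<bar>indicat_real A x - indicat_real A y\<bar> = k x y * (indicat_real A x - indicat_real A y)" for y
      by (simp add: indicator_def)
    moreover have "0 \<le> (\<integral>y. k x y * (indicat_real A x - indicat_real A y) \<partial>M)"
      using True by (intro integral_nonneg_AE AE_I2) (auto simp: kernel_nonneg indicator_def)
    ultimately show ?thesis by (simp only: abs_of_nonneg)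
  next
    case False
    then have "k x y * \<bar>indicat_real A x - indicat_real A y\<bar> = k x y * indicat_real A y"
      "k x y * (indicat_real A x - indicat_real A y) = - (k x y * indicat_real A y)" for y
      by (simp_all add: indicator_def)
    moreover have "0 \<le> (\<integral>y. k x y * indicat_real A y \<partial>M)"
      by (intro integral_nonneg_AE AE_I2) (auto simp: kernel_nonneg)
    ultimately show ?thesis by (simp only: integral_minus abs_minus_cancel abs_of_nonneg)
  qed
  then show "ennreal \<bar>indicat_real A x - K (indicat_real A) x\<bar> =
      (\<integral>\<^sup>+y. ennreal (k x y * \<bar>indicat_real A x - indicat_real A y\<bar>) \<partial>M)"
    unfolding * using ja by (simp add: nn_integral_eq_integral kernel_nonneg)
qed

end

subsection \<open>The heat kernel of a sub-Gaussian Dirichlet space\<close>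

context sub_gaussian_dirichlet_space
begin

section \<open>Consequences of regularity and full support of the measure\<close>

lemma sets_M [measurable_cong]: "sets M = sets borel"
  using radon by (simp add: radon_measure_def)

lemma space_M [simp]: "space M = UNIV"
  using sets_eq_imp_space_eq[OF sets_M] by simp

lemma emeasure_ball_finite: "emeasure M (ball x r) < \<infinity>"
proof (cases "0 \<le> r")
  case True
  then show ?thesis using ahlfors unfolding ahlfors_regular_def
    by (metis ennreal_less_top infinity_ennreal_def le_less_trans)
next
  case False
  then show ?thesis by (simp add: ball_empty)
qed

lemma emeasure_open_pos: "open U \<Longrightarrow> x \<in> U \<Longrightarrow> 0 < emeasure M U"
  using support by (auto simp: full_support_def)

sublocale sigma_finite_measure M
proof
  fix x0 :: 'a
  have "\<exists>n::nat. dist x0 x < real n" for x by (rule reals_Archimedean2)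
  then show "\<exists>A. countable A \<and> A \<subseteq> sets M \<and> \<Union> A = space M \<and> (\<forall>a\<in>A. emeasure M a \<noteq> \<infinity>)"
    using emeasure_ball_finite[of x0]
    by (intro exI[of _ "range (\<lambda>n::nat. ball x0 (real n))"]) (auto simp: sets_M less_top[symmetric])
qed

sublocale pair: pair_sigma_finite M M ..

lemma sets_pair_M: "sets (M \<Otimes>\<^sub>M M) = sets (borel \<Otimes>\<^sub>M borel)"
  by (intro sets_pair_measure_cong sets_M)

lemma continuous_measurable_pair:
  fixes g :: "'a \<times> 'a \<Rightarrow> 'b::topological_space"
  shows "continuous_on UNIV g \<Longrightarrow> g \<in> borel_measurable (M \<Otimes>\<^sub>M M)"
  using continuous_imp_measurable_pair_borel[OF compact_balls]
  by (simp add: measurable_cong_sets[OF sets_pair_M refl])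

text \<open>The exceptional set is open and null, hence empty by full support.\<close>

lemma AE_closed_imp_all:
  assumes "closed {x. Q x}" "AE x in M. Q x"
  shows "Q x"
proof (rule ccontr)
  assume "\<not> Q x"
  have "open {x. \<not> Q x}" using assms(1) by (simp add: closed_def Collect_neg_eq)
  then have "emeasure M {x. \<not> Q x} = 0"
    using assms(2) by (subst (asm) AE_iff_measurable[OF _ refl]) (auto simp: sets_M)
  then show False using emeasure_open_pos[OF \<open>open {x. \<not> Q x}\<close>, of x] \<open>\<not> Q x\<close> by simp
qed

text \<open>The exceptional set is open, and if it were nonempty it would contain an open rectangle,
  whose measure is a product of two positive quantities.\<close>

lemma AE_pair_closed_imp_all:
  assumes "closed {(x, y). Q x y}" "AE (x, y) in M \<Otimes>\<^sub>M M. Q x y"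
  shows "Q x y"
proof (rule ccontr)
  assume "\<not> Q x y"
  let ?W = "{(x, y). \<not> Q x y}"
  have "?W = - {(x, y). Q x y}" by auto
  then have "open ?W" using assms(1) by (simp add: closed_def)
  then obtain U V where UV: "open U" "open V" "x \<in> U" "y \<in> V" "U \<times> V \<subseteq> ?W"
    using open_prod_rect[of ?W x y] \<open>\<not> Q x y\<close> by auto
  have W: "?W \<in> sets (M \<Otimes>\<^sub>M M)"
    using open_in_sets_pair_borel[OF compact_balls \<open>open ?W\<close>] by (simp add: sets_pair_M)
  have "emeasure (M \<Otimes>\<^sub>M M) ?W = 0"
    using assms(2) W
    by (subst (asm) AE_iff_measurable[of ?W]) (auto simp: space_pair_measure)
  then have "emeasure (M \<Otimes>\<^sub>M M) (U \<times> V) = 0"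
    using emeasure_mono[OF UV(5) W] by simp
  moreover have "emeasure (M \<Otimes>\<^sub>M M) (U \<times> V) = emeasure M U * emeasure M V"
    by (rule emeasure_pair_measure_Times) (use UV in \<open>simp_all add: sets_M\<close>)
  ultimately have "emeasure M U * emeasure M V = 0" by simp
  then show False using UV emeasure_open_pos by (metis less_irrefl mult_eq_0_iff)
qed

section \<open>Everywhere versions of the kernel bounds, and the semigroup law\<close>

lemma kernel_continuous: "0 < t \<Longrightarrow> continuous_on UNIV (\<lambda>(x, y). p t x y)"
  using kernel by (auto simp: continuous_heat_kernel_def)

lemma kernel_measurable: "0 < t \<Longrightarrow> (\<lambda>(x, y). p t x y) \<in> borel_measurable (M \<Otimes>\<^sub>M M)"
  by (intro continuous_measurable_pair kernel_continuous)

lemma kernel_measurable2: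
  assumes "0 < t" "f \<in> N \<rightarrow>\<^sub>M M" "g \<in> N \<rightarrow>\<^sub>M M"
  shows "(\<lambda>z. p t (f z) (g z)) \<in> borel_measurable N"
  using measurable_compose[OF measurable_Pair[OF assms(2,3)] kernel_measurable[OF assms(1)]] by simp

text \<open>For each fixed time both bounds are closed conditions on the pair of points, by
  continuity of the kernel, and so extend from almost every pair to every pair.\<close>

lemma kernel_bounds:
  "\<exists>c3>0. \<exists>c4>0. \<exists>c5>0. \<exists>c6>0. \<forall>t>0. \<forall>x y.
    c5 * t powr (- d\<^sub>H / d\<^sub>W) * exp (- c6 * (dist x y powr d\<^sub>W / t) powr (1 / (d\<^sub>W - 1))) \<le> p t x y \<and>
    p t x y \<le> c3 * t powr (- d\<^sub>H / d\<^sub>W) * exp (- c4 * (dist x y powr d\<^sub>W / t) powr (1 / (d\<^sub>W - 1)))"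
proof -
  obtain c3 c4 c5 c6 where c: "0 < c3" "0 < c4" "0 < c5" "0 < c6"
    and AE: "AE (x, y) in M \<Otimes>\<^sub>M M. \<forall>t>0.
        c5 * t powr (- d\<^sub>H / d\<^sub>W) * exp (- c6 * (dist x y powr d\<^sub>W / t) powr (1 / (d\<^sub>W - 1))) \<le> p t x y \<and>
        p t x y \<le> c3 * t powr (- d\<^sub>H / d\<^sub>W) * exp (- c4 * (dist x y powr d\<^sub>W / t) powr (1 / (d\<^sub>W - 1)))"
    using bounds unfolding sub_gaussian_bounds_def by blast
  have "c5 * t powr (- d\<^sub>H / d\<^sub>W) * exp (- c6 * (dist x y powr d\<^sub>W / t) powr (1 / (d\<^sub>W - 1))) \<le> p t x y \<and>
        p t x y \<le> c3 * t powr (- d\<^sub>H / d\<^sub>W) * exp (- c4 * (dist x y powr d\<^sub>W / t) powr (1 / (d\<^sub>W - 1)))"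
    if t: "0 < t" for t x y
  proof (rule AE_pair_closed_imp_all)
    have p: "continuous_on UNIV (\<lambda>z. p t (fst z) (snd z))"
      using kernel_continuous[OF t] by (simp add: case_prod_beta)
    have d: "continuous_on UNIV (\<lambda>z::'a \<times> 'a. (dist (fst z) (snd z) powr d\<^sub>W / t) powr (1 / (d\<^sub>W - 1)))"
      using walk_dim t by (intro continuous_on_powr' continuous_intros) auto
    show "closed {(x, y). c5 * t powr (- d\<^sub>H / d\<^sub>W) * exp (- c6 * (dist x y powr d\<^sub>W / t) powr (1 / (d\<^sub>W - 1))) \<le> p t x y \<and>
        p t x y \<le> c3 * t powr (- d\<^sub>H / d\<^sub>W) * exp (- c4 * (dist x y powr d\<^sub>W / t) powr (1 / (d\<^sub>W - 1)))}"
      unfolding case_prod_beta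
      by (intro closed_Collect_conj closed_Collect_le continuous_intros p d)
  qed (use AE t in \<open>auto simp: case_prod_beta elim!: AE_mp\<close>)
  with c show ?thesis by blast
qed

lemma kernel_nonneg:
  assumes "0 < t"
  shows "0 \<le> p t x y"
proof -
  obtain c5 c6 where "0 < c5"
    "c5 * t powr (- d\<^sub>H / d\<^sub>W) * exp (- c6 * (dist x y powr d\<^sub>W / t) powr (1 / (d\<^sub>W - 1))) \<le> p t x y"
    using kernel_bounds assms by blast
  moreover from this have "0 \<le> c5 * t powr (- d\<^sub>H / d\<^sub>W) * exp (- c6 * (dist x y powr d\<^sub>W / t) powr (1 / (d\<^sub>W - 1)))"
    by simp
  ultimately show ?thesis by linarith
qed

lemma heat_op_measurable:
  assumes "0 < t" and [measurable]: "g \<in> borel_measurable M"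
  shows "heat_op M p t g \<in> borel_measurable M"
proof -
  note [measurable] = kernel_measurable2[OF assms(1)]
  show ?thesis unfolding heat_op_def by measurable
qed

lemma indicator_L2: "A \<in> sets M \<Longrightarrow> emeasure M A < \<infinity> \<Longrightarrow> indicat_real A \<in> L2 M"
  unfolding L2_def by (auto simp: power2_eq_square simp flip: indicator_inter_arith)

text \<open>Links the integral operator, defined at every point, with the abstract semigroup, whose
  laws are given only up to null sets.\<close>

lemma heat_op_eq_semigroup:
  obtains P where "heat_semigroup M E F P"
    and "\<And>t g. 0 < t \<Longrightarrow> g \<in> L2 M \<Longrightarrow> AE x in M. heat_op M p t g x = P t g x"
proof -
  obtain P where P: "heat_semigroup M E F P"
    "\<And>t g. 0 < t \<Longrightarrow> g \<in> L2 M \<Longrightarrow> AE x in M. has_bochner_integral M (\<lambda>y. p t x y * g y) (P t g x)"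
    using kernel unfolding continuous_heat_kernel_def by blast
  show thesis
  proof (rule that[OF P(1)])
    fix t :: real and g assume "0 < t" "g \<in> L2 M"
    from P(2)[OF this] show "AE x in M. heat_op M p t g x = P t g x"
      by eventually_elim (simp add: heat_op_def has_bochner_integral_integral_eq)
  qed
qed

lemma heat_op_L2:
  assumes "0 < t" "g \<in> L2 M"
  shows "heat_op M p t g \<in> L2 M"
proof -
  obtain P where P: "heat_semigroup M E F P"
    "\<And>t g. 0 < t \<Longrightarrow> g \<in> L2 M \<Longrightarrow> AE x in M. heat_op M p t g x = P t g x"
    using heat_op_eq_semigroup by blast
  have [measurable]: "heat_op M p t g \<in> borel_measurable M"
    using assms by (intro heat_op_measurable) (auto simp: L2_def)
  have Pt: "P t g \<in> L2 M" using heat_semigroup.P_L2[OF P(1)] assms by simp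
  then have [measurable]: "P t g \<in> borel_measurable M" by (simp add: L2_def)
  have "integrable M (\<lambda>x. (heat_op M p t g x)\<^sup>2) = integrable M (\<lambda>x. (P t g x)\<^sup>2)"
    using P(2)[OF assms] by (intro integrable_cong_AE) auto
  then show ?thesis using Pt by (simp add: L2_def)
qed

lemma heat_op_semigroup:
  assumes s: "0 < s" and t: "0 < t" and g: "g \<in> L2 M"
  shows "AE x in M. heat_op M p (s + t) g x = heat_op M p s (heat_op M p t g) x"
proof -
  obtain P where P: "heat_semigroup M E F P"
    "\<And>t g. 0 < t \<Longrightarrow> g \<in> L2 M \<Longrightarrow> AE x in M. heat_op M p t g x = P t g x"
    using heat_op_eq_semigroup by blast
  note [measurable] = kernel_measurable2[OF s]
  have Pt: "P t g \<in> L2 M" using heat_semigroup.P_L2[OF P(1)] t g by simp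
  then have [measurable]: "P t g \<in> borel_measurable M" by (simp add: L2_def)
  have [measurable]: "heat_op M p t g \<in> borel_measurable M"
    using heat_op_L2[OF t g] by (simp add: L2_def)
  \<comment> \<open>An integral does not see null sets, so exchanging the inner function under the
    outer operator is an equality at every \<open>x\<close>.\<close>
  have "heat_op M p s (P t g) x = heat_op M p s (heat_op M p t g) x" for x
    unfolding heat_op_def[of M p s] using P(2)[OF t g] by (intro integral_cong_AE) auto
  moreover have "AE x in M. heat_op M p (s + t) g x = P (s + t) g x"
    using P(2) s t g by simp
  moreover have "AE x in M. P (s + t) g x = P s (P t g) x"
    using heat_semigroup.P_add[OF P(1)] s t g by simp
  moreover have "AE x in M. heat_op M p s (P t g) x = P s (P t g) x"
    using P(2)[OF s Pt] .
  ultimately show ?thesis by (auto elim: AE_mp)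
qed

section \<open>Symmetry and mass bounds of the heat kernel\<close>

lemma ahlfors_measure:
  obtains c1 c2 where "0 < c1" "0 < c2"
    "\<And>x r. 0 \<le> r \<Longrightarrow> c1 * r powr d\<^sub>H \<le> measure M (ball x r)"
    "\<And>x r. 0 \<le> r \<Longrightarrow> measure M (ball x r) \<le> c2 * r powr d\<^sub>H"
proof -
  obtain c1 c2 where c: "0 < c1" "0 < c2"
    "\<And>x r. 0 \<le> r \<Longrightarrow> ennreal (c1 * r powr d\<^sub>H) \<le> emeasure M (ball x r)"
    "\<And>x r. 0 \<le> r \<Longrightarrow> emeasure M (ball x r) \<le> ennreal (c2 * r powr d\<^sub>H)"
    using ahlfors unfolding ahlfors_regular_def by blast
  have e: "emeasure M (ball x r) = ennreal (measure M (ball x r))" for x r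
    using emeasure_ball_finite[of x r] by (simp add: emeasure_eq_ennreal_measure)
  show thesis
    using c unfolding e by (intro that[of c1 c2]) (auto simp: ennreal_le_iff)
qed

text \<open>If the two values differed, continuity would separate \<open>p t a b\<close> from
  \<open>p t b a\<close> by constants \<open>c < c'\<close> on a small rectangle
  \<open>A \<times> B\<close>. Pairing the indicators of \<open>A\<close> and \<open>B\<close>
  through the semigroup then contradicts its self-adjointness.\<close>

lemma kernel_sym:
  assumes t: "0 < t"
  shows "p t x y = p t y x"
proof -
  have le: "p t x y \<le> p t y x" for x y
  proof (rule ccontr)
    assume "\<not> p t x y \<le> p t y x"
    then obtain c c' where c: "p t y x < c" "c < c'" "c' < p t x y" by (metis dense not_le)
    have pos: "0 < c" using c kernel_nonneg[OF t, of y x] by simp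
    have op: "open {z. c' < p t (fst z) (snd z) \<and> p t (snd z) (fst z) < c}"
    proof (intro open_Collect_conj open_Collect_less continuous_intros)
      show "continuous_on UNIV (\<lambda>z. p t (fst z) (snd z))"
        using kernel_continuous[OF t] by (simp add: case_prod_beta)
      then show "continuous_on UNIV (\<lambda>z. p t (snd z) (fst z))"
        using continuous_on_compose[OF continuous_on_swap, of UNIV "\<lambda>z. p t (fst z) (snd z)"]
        by (auto simp: comp_def prod.swap_def intro: continuous_on_subset)
    qed
    obtain U V where UV: "open U" "open V" "x \<in> U" "y \<in> V"
      "U \<times> V \<subseteq> {z. c' < p t (fst z) (snd z) \<and> p t (snd z) (fst z) < c}"
      using open_prod_rect[OF op, of x y] c by auto
    \<comment> \<open>Cutting with unit balls keeps the measures finite, so that the indicators lie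
      in \<open>L2 M\<close>.\<close>
    define A where "A = U \<inter> ball x 1"
    define B where "B = V \<inter> ball y 1"
    have AB: "open A" "open B" "x \<in> A" "y \<in> B" and [measurable]: "A \<in> sets M" "B \<in> sets M"
      using UV by (auto simp: A_def B_def sets_M)
    have fin: "emeasure M A < \<infinity>" "emeasure M B < \<infinity>"
      unfolding A_def B_def
      by (rule le_less_trans[OF emeasure_mono[OF Int_lower2] emeasure_ball_finite], simp add: sets_M)+
    have ineq: "c' < p t a b" "p t b a < c" if "a \<in> A" "b \<in> B" for a b
      using subsetD[OF UV(5), of "(a, b)"] that unfolding A_def B_def by auto
    obtain P where P: "heat_semigroup M E F P"
      "\<And>t g. 0 < t \<Longrightarrow> g \<in> L2 M \<Longrightarrow> AE x in M. heat_op M p t g x = P t g x"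
      using heat_op_eq_semigroup by blast
    let ?H = "\<lambda>C D. \<integral>x. heat_op M p t (indicat_real D) x * indicat_real C x \<partial>M"
    note [measurable] = kernel_measurable2[OF t] heat_op_measurable[OF t]
    note L = indicator_L2[OF _ fin(1)] indicator_L2[OF _ fin(2)]
    have [measurable]: "P t (indicat_real A) \<in> borel_measurable M" "P t (indicat_real B) \<in> borel_measurable M"
      using heat_semigroup.P_L2[OF P(1), of t] t L by (auto simp: L2_def)
    have H: "?H C D = L2_inner M (P t (indicat_real D)) (indicat_real C)"
      if "D = A \<or> D = B" "C = A \<or> C = B" for C D
      unfolding L2_inner_def using P(2)[OF t, of "indicat_real D"] that L
      by (intro integral_cong_AE) auto
    have HAB: "?H A B = ?H B A"
      using H heat_semigroup.P_sym[OF P(1), of t "indicat_real B" "indicat_real A"] t L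
      by (simp add: L2_inner_def mult.commute)
    have ub: "\<bar>p t b a\<bar> \<le> c" if "a \<in> A" "b \<in> B" for a b
      using ineq(2)[OF that] kernel_nonneg[OF t, of b a] by simp
    have h1: "heat_op M p t (indicat_real A) b \<le> c * measure M A" if "b \<in> B" for b
    proof -
      have "heat_op M p t (indicat_real A) b \<le> (\<integral>a. c * indicat_real A a \<partial>M)"
        unfolding heat_op_def
      proof (rule integral_mono')
        show "integrable M (\<lambda>a. c * indicat_real A a)" using fin by (auto simp: less_top[symmetric])
      qed (use ub that pos in \<open>auto simp: indicator_def abs_le_iff\<close>)
      then show ?thesis by simp
    qed
    have h1': "0 \<le> heat_op M p t (indicat_real A) b" for b
      unfolding heat_op_def by (intro integral_nonneg_AE AE_I2) (auto simp: kernel_nonneg[OF t])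
    have "?H B A \<le> (\<integral>b. (c * measure M A) * indicat_real B b \<partial>M)"
    proof (rule integral_mono')
      show "integrable M (\<lambda>b. (c * measure M A) * indicat_real B b)" using fin by (auto simp: less_top[symmetric])
    qed (use h1 h1' pos in \<open>auto simp: indicator_def\<close>)
    then have u: "?H B A \<le> c * measure M A * measure M B" by simp
    obtain c3 c4 where c34: "0 < c3" "0 < c4" "\<And>x y. p t x y \<le> c3 * t powr (- d\<^sub>H / d\<^sub>W) * exp (- c4 * (dist x y powr d\<^sub>W / t) powr (1 / (d\<^sub>W - 1)))"
      using kernel_bounds t by metis
    have pK: "p t x y \<le> c3 * t powr (- d\<^sub>H / d\<^sub>W)" for x y
      using c34 by (intro order_trans[OF c34(3)] mult_left_le) auto
    have i2: "integrable M (\<lambda>b. p t a b * indicat_real B b)" for a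
    proof (rule Bochner_Integration.integrable_bound)
      show "integrable M (\<lambda>b. c3 * t powr (- d\<^sub>H / d\<^sub>W) * indicat_real B b)" using fin by (auto simp: less_top[symmetric])
    qed (use pK c34 in \<open>auto simp: indicator_def kernel_nonneg[OF t]\<close>)
    have h2: "c' * measure M B \<le> heat_op M p t (indicat_real B) a" if "a \<in> A" for a
    proof -
      have "(\<integral>b. c' * indicat_real B b \<partial>M) \<le> heat_op M p t (indicat_real B) a"
        unfolding heat_op_def
      proof (rule integral_mono[OF _ i2])
        show "integrable M (\<lambda>a. c' * indicat_real B a)" using fin by (auto simp: less_top[symmetric])
      qed (use ineq(1) that in \<open>auto simp: indicator_def less_imp_le\<close>)
      then show ?thesis by simp
    qed
    have h3: "heat_op M p t (indicat_real B) a \<le> c3 * t powr (- d\<^sub>H / d\<^sub>W) * measure M B" for a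
    proof -
      have "heat_op M p t (indicat_real B) a \<le> (\<integral>b. c3 * t powr (- d\<^sub>H / d\<^sub>W) * indicat_real B b \<partial>M)"
        unfolding heat_op_def
      proof (rule integral_mono[OF i2])
        show "integrable M (\<lambda>a. c3 * t powr (- d\<^sub>H / d\<^sub>W) * indicat_real B a)" using fin by (auto simp: less_top[symmetric])
      qed (use pK in \<open>auto simp: indicator_def\<close>)
      then show ?thesis by simp
    qed
    have h2': "0 \<le> heat_op M p t (indicat_real B) b" for b
      unfolding heat_op_def by (intro integral_nonneg_AE AE_I2) (auto simp: kernel_nonneg[OF t])
    have "(\<integral>a. (c' * measure M B) * indicat_real A a \<partial>M) \<le> ?H A B"
    proof (rule integral_mono)
      show "integrable M (\<lambda>b. (c' * measure M B) * indicat_real A b)" using fin by (auto simp: less_top[symmetric])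
      show "integrable M (\<lambda>x. heat_op M p t (indicat_real B) x * indicat_real A x)"
      proof (rule Bochner_Integration.integrable_bound)
        show "integrable M (\<lambda>a. (c3 * t powr (- d\<^sub>H / d\<^sub>W) * measure M B) * indicat_real A a)"
          using fin by (auto simp: less_top[symmetric])
      qed (use h3 h2' c34 in \<open>auto simp: indicator_def\<close>)
    qed (use h2 in \<open>auto simp: indicator_def\<close>)
    then have "c' * measure M A * measure M B \<le> ?H A B" by (simp add: mult_ac)
    with u HAB have "c' * (measure M A * measure M B) \<le> c * (measure M A * measure M B)" by simp
    moreover have "0 < measure M A * measure M B"
      using emeasure_open_pos[OF AB(1,3)] emeasure_open_pos[OF AB(2,4)] fin
      by (auto simp: measure_def enn2real_positive_iff less_top[symmetric])
    ultimately show False using c by (simp add: mult_le_cancel_right)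
  qed
  then show ?thesis by (intro antisym)
qed

text \<open>Cut the space into annuli of width \<open>R = t powr (1 / d\<^sub>W)\<close>. On annulus
  number \<open>j\<close> the kernel carries the factor \<open>exp (- c4 * real j)\<close> while the
  volume grows only like a power of \<open>j\<close>, and the powers of \<open>t\<close> cancel, so
  the series \<open>a\<close> is independent of time.\<close>

lemma kernel_mass_upper:
  "\<exists>B>0. \<forall>t>0. \<forall>x. (\<integral>\<^sup>+y. ennreal (p t x y) \<partial>M) \<le> ennreal B"
proof -
  obtain c3 c4 where c34: "0 < c3" "0 < c4" and ub: "\<And>t x y. 0 < t \<Longrightarrow>
      p t x y \<le> c3 * t powr (- d\<^sub>H / d\<^sub>W) * exp (- c4 * (dist x y powr d\<^sub>W / t) powr (1 / (d\<^sub>W - 1)))"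
    using kernel_bounds by metis
  obtain c2 where c2: "0 < c2" and vol: "\<And>x r. 0 \<le> r \<Longrightarrow> measure M (ball x r) \<le> c2 * r powr d\<^sub>H"
    using ahlfors_measure by metis
  define a where "a j = c3 * c2 * (exp (- c4 * real j) * real (Suc j) powr d\<^sub>H)" for j
  have "summable (\<lambda>j. exp (- c4 * real j) * real (Suc j) powr d\<^sub>H)"
  proof (rule summable_comparison_test_bigo)
    have "(\<lambda>j. exp (- c4 / 2) ^ j) = (\<lambda>j. exp (- c4 / 2 * real j))"
      by (simp add: mult.commute flip: exp_of_nat_mult)
    moreover have "summable (\<lambda>j. exp (- c4 / 2) ^ j)" using c34 by (intro summable_geometric) simp
    ultimately show "summable (\<lambda>j. norm (exp (- c4 / 2 * real j)))" by simp
    show "(\<lambda>j. exp (- c4 * real j) * real (Suc j) powr d\<^sub>H) \<in> O(\<lambda>j. exp (- c4 / 2 * real j))"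
      using c34 by real_asymp
  qed
  then have sa: "summable a" unfolding a_def by (rule summable_mult)
  have a0: "0 \<le> a j" for j using c34 c2 by (simp add: a_def)
  show ?thesis
  proof (intro exI[of _ "suminf a + 1"] conjI allI impI)
    show "0 < suminf a + 1" using suminf_nonneg[OF sa a0] by simp
    fix t :: real and x :: 'a assume t: "0 < t"
    define R where "R = t powr (1 / d\<^sub>W)"
    have R: "0 < R" "R powr d\<^sub>W = t" using t walk_dim by (auto simp: R_def powr_powr)
    have RH: "R powr d\<^sub>H = t powr (d\<^sub>H / d\<^sub>W)" using t walk_dim by (simp add: R_def powr_powr)
    define f where "f j y = ennreal (c3 * t powr (- d\<^sub>H / d\<^sub>W) * exp (- c4 * real j)) * indicator (ball x (real (Suc j) * R)) y"
      for j y
    have le: "ennreal (p t x y) \<le> (\<Sum>j. f j y)" for y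
    proof -
      define j where "j = nat \<lfloor>dist x y / R\<rfloor>"
      have j: "real j * R \<le> dist x y" "dist x y < real (Suc j) * R"
      proof -
        have "0 \<le> dist x y / R" using R by simp
        then have "real j \<le> dist x y / R" "dist x y / R < real (Suc j)"
          unfolding j_def by linarith+
        then show "real j * R \<le> dist x y" "dist x y < real (Suc j) * R"
          using R by (auto simp: field_simps)
      qed
      have "real j \<le> (dist x y powr d\<^sub>W / t) powr (1 / (d\<^sub>W - 1))"
      proof (cases "j = 0")
        case False
        \<comment> \<open>The exponent \<open>d\<^sub>W / (d\<^sub>W - 1)\<close> exceeds one, so
          for \<open>j \<ge> 1\<close> the decay is at least exponential in
          \<open>j\<close>.\<close>
        have "real j powr 1 \<le> real j powr (d\<^sub>W * (1 / (d\<^sub>W - 1)))"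
          using False walk_dim by (intro powr_mono) (auto simp: field_simps)
        also have "\<dots> = ((real j * R) powr d\<^sub>W / t) powr (1 / (d\<^sub>W - 1))"
          using R t by (simp add: powr_mult powr_powr)
        also have "\<dots> \<le> (dist x y powr d\<^sub>W / t) powr (1 / (d\<^sub>W - 1))"
          using j R t walk_dim by (intro powr_mono2 divide_right_mono) auto
        finally show ?thesis by simp
      qed simp
      then have "p t x y \<le> c3 * t powr (- d\<^sub>H / d\<^sub>W) * exp (- c4 * real j)"
        using c34 by (intro order_trans[OF ub[OF t]] mult_left_mono) auto
      then have "ennreal (p t x y) \<le> f j y"
        using j unfolding f_def by (simp add: ennreal_leI)
      also have "\<dots> \<le> (\<Sum>j. f j y)"
        using sum_le_suminf[of "\<lambda>j. f j y" "{j}"] by simp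
      finally show ?thesis .
    qed
    have "(\<integral>\<^sup>+y. ennreal (p t x y) \<partial>M) \<le> (\<integral>\<^sup>+y. (\<Sum>j. f j y) \<partial>M)"
      by (intro nn_integral_mono le)
    also have "\<dots> = (\<Sum>j. \<integral>\<^sup>+y. f j y \<partial>M)"
    proof (rule nn_integral_suminf)
      show "f j \<in> borel_measurable M" for j
        unfolding f_def
        by (intro borel_measurable_times_ennreal borel_measurable_const borel_measurable_indicator) (simp add: sets_M)
    qed
    also have "\<dots> \<le> (\<Sum>j. ennreal (a j))"
    proof (intro suminf_le summableI)
      fix j
      have "(\<integral>\<^sup>+y. f j y \<partial>M) = ennreal (c3 * t powr (- d\<^sub>H / d\<^sub>W) * exp (- c4 * real j)) * emeasure M (ball x (real (Suc j) * R))"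
        unfolding f_def by (simp add: nn_integral_cmult_indicator sets_M)
      also have "\<dots> = ennreal (c3 * t powr (- d\<^sub>H / d\<^sub>W) * exp (- c4 * real j) * measure M (ball x (real (Suc j) * R)))"
        using emeasure_ball_finite[of x "real (Suc j) * R"] c34
        by (simp add: emeasure_eq_ennreal_measure ennreal_mult)
      also have "\<dots> \<le> ennreal (c3 * t powr (- d\<^sub>H / d\<^sub>W) * exp (- c4 * real j) * (c2 * (real (Suc j) * R) powr d\<^sub>H))"
        using c34 R by (intro ennreal_leI mult_left_mono vol) auto
      also have "c3 * t powr (- d\<^sub>H / d\<^sub>W) * exp (- c4 * real j) * (c2 * (real (Suc j) * R) powr d\<^sub>H) = a j"
        using R t by (simp only: a_def powr_mult RH powr_minus_divide minus_divide_left[symmetric]) (simp add: field_simps)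
      finally show "(\<integral>\<^sup>+y. f j y \<partial>M) \<le> ennreal (a j)" .
    qed
    also have "\<dots> = ennreal (suminf a)" using sa a0 by (simp add: suminf_ennreal2)
    also have "\<dots> \<le> ennreal (suminf a + 1)" by (intro ennreal_leI) simp
    finally show "(\<integral>\<^sup>+y. ennreal (p t x y) \<partial>M) \<le> ennreal (suminf a + 1)" .
  qed
qed

lemma kernel_integrable:
  assumes t: "0 < t"
  shows "integrable M (p t x)"
proof -
  note [measurable] = kernel_measurable2[OF t]
  obtain B where "(\<integral>\<^sup>+y. ennreal (p t x y) \<partial>M) \<le> ennreal B"
    using kernel_mass_upper t by blast
  then have "(\<integral>\<^sup>+y. ennreal (p t x y) \<partial>M) < \<infinity>" by (rule le_less_trans) simp
  then show ?thesis
    using kernel_nonneg[OF t] by (intro integrableI_nonneg) auto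
qed

lemma AE_ex:
  assumes "AE x in M. Q x"
  shows "\<exists>x. Q x"
proof (rule ccontr)
  assume "\<nexists>x. Q x"
  then have "AE x in M. x \<notin> UNIV" using assms by (auto elim: AE_mp)
  then have "emeasure M UNIV = 0" by (subst (asm) AE_iff_measurable[of UNIV]) auto
  then show False using emeasure_open_pos[of UNIV undefined] by simp
qed

lemma heat_op_one_upper: "\<exists>B>0. \<forall>t>0. \<forall>x. heat_op M p t (\<lambda>_. 1) x \<le> B"
proof -
  obtain B where B: "0 < B" "\<And>t x. 0 < t \<Longrightarrow> (\<integral>\<^sup>+y. ennreal (p t x y) \<partial>M) \<le> ennreal B"
    using kernel_mass_upper by blast
  have "heat_op M p t (\<lambda>_. 1) x \<le> B" if t: "0 < t" for t x
    using B(2)[OF t, of x] B(1) kernel_integrable[OF t, of x] kernel_nonneg[OF t]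
    by (simp add: heat_op_def nn_integral_eq_integral)
  with B(1) show ?thesis by blast
qed

text \<open>It suffices to integrate over the ball of radius \<open>t powr (1 / d\<^sub>W)\<close>:
  there the lower bound loses at most the factor \<open>exp (- c6)\<close>, and the volume cancels
  the power of \<open>t\<close>.\<close>

lemma heat_op_one_lower: "\<exists>e>0. \<forall>t>0. \<forall>x. e \<le> heat_op M p t (\<lambda>_. 1) x"
proof -
  obtain c5 c6 where c: "0 < c5" "0 < c6" and lb: "\<And>t x y. 0 < t \<Longrightarrow>
      c5 * t powr (- d\<^sub>H / d\<^sub>W) * exp (- c6 * (dist x y powr d\<^sub>W / t) powr (1 / (d\<^sub>W - 1))) \<le> p t x y"
    using kernel_bounds by metis
  obtain c1 where c1: "0 < c1" and vol: "\<And>x r. 0 \<le> r \<Longrightarrow> c1 * r powr d\<^sub>H \<le> measure M (ball x r)"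
    using ahlfors_measure by metis
  have "c5 * exp (- c6) * c1 \<le> heat_op M p t (\<lambda>_. 1) x" if t: "0 < t" for t x
  proof -
    define R where "R = t powr (1 / d\<^sub>W)"
    have R: "0 < R" "R powr d\<^sub>W = t" using t walk_dim by (auto simp: R_def powr_powr)
    have RH: "R powr d\<^sub>H = t powr (d\<^sub>H / d\<^sub>W)" using t walk_dim by (simp add: R_def powr_powr)
    let ?c = "c5 * t powr (- d\<^sub>H / d\<^sub>W) * exp (- c6)"
    have "c5 * exp (- c6) * c1 = ?c * (c1 * R powr d\<^sub>H)"
      using t by (simp add: RH powr_minus field_simps)
    also have "\<dots> \<le> ?c * measure M (ball x R)"
      using c R by (intro mult_left_mono vol) auto
    also have "\<dots> = (\<integral>y. ?c * indicator (ball x R) y \<partial>M)" by simp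
    also have "\<dots> \<le> (\<integral>y. p t x y * 1 \<partial>M)"
    proof (rule integral_mono)
      show "integrable M (\<lambda>y. ?c * indicator (ball x R) y)"
        using emeasure_ball_finite[of x R] by (auto simp: sets_M less_top[symmetric])
      show "integrable M (\<lambda>y. p t x y * 1)" using kernel_integrable[OF t] by simp
      fix y
      show "?c * indicator (ball x R) y \<le> p t x y * 1"
      proof (cases "y \<in> ball x R")
        case True
        then have "(dist x y powr d\<^sub>W / t) powr (1 / (d\<^sub>W - 1)) \<le> 1"
          using R walk_dim t powr_mono2[of d\<^sub>W "dist x y" R] powr_mono2[of "1 / (d\<^sub>W - 1)" "dist x y powr d\<^sub>W / t" 1]
          by simp
        then have "?c \<le> c5 * t powr (- d\<^sub>H / d\<^sub>W) * exp (- c6 * (dist x y powr d\<^sub>W / t) powr (1 / (d\<^sub>W - 1)))"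
          using c mult_left_mono[of _ 1 c6] by (intro mult_left_mono) auto
        then show ?thesis using lb[OF t, of x y] True by simp
      qed (simp add: kernel_nonneg[OF t])
    qed
    finally show ?thesis unfolding heat_op_def .
  qed
  with c c1 show ?thesis by (intro exI[of _ "c5 * exp (- c6) * c1"]) auto
qed

section \<open>Conservativeness of the heat semigroup\<close>

lemma heat_op_tendsto:
  assumes t: "0 < t" and [measurable]: "\<And>n. g n \<in> borel_measurable M" "h \<in> borel_measurable M"
    and B: "\<And>n y. \<bar>g n y\<bar> \<le> B" and lim: "\<And>y. (\<lambda>n. g n y) \<longlonglongrightarrow> h y"
  shows "(\<lambda>n. heat_op M p t (g n) x) \<longlonglongrightarrow> heat_op M p t h x"
  unfolding heat_op_def
proof (rule integral_dominated_convergence)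
  note [measurable] = kernel_measurable2[OF t]
  show "integrable M (\<lambda>y. B * p t x y)" using kernel_integrable[OF t] by simp
  show "(\<lambda>y. p t x y * h y) \<in> borel_measurable M" "\<And>n. (\<lambda>y. p t x y * g n y) \<in> borel_measurable M"
    by measurable
  show "AE y in M. (\<lambda>n. p t x y * g n y) \<longlonglongrightarrow> p t x y * h y"
    by (intro AE_I2 tendsto_intros lim)
  show "\<And>n. AE y in M. norm (p t x y * g n y) \<le> B * p t x y"
    using mult_left_mono[OF B kernel_nonneg[OF t]]
    by (intro AE_I2) (simp add: abs_mult kernel_nonneg[OF t] mult.commute)
qed

text \<open>The constant one is not square integrable, so the semigroup law is applied to indicators
  of balls exhausting the space, followed by dominated convergence.\<close>

lemma heat_op_one_semigroup:
  assumes s: "0 < s" and t: "0 < t"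
  shows "AE x in M. heat_op M p (s + t) (\<lambda>_. 1) x = heat_op M p s (heat_op M p t (\<lambda>_. 1)) x"
proof -
  fix x0 :: 'a
  obtain B where B: "\<And>t x. 0 < t \<Longrightarrow> heat_op M p t (\<lambda>_. 1) x \<le> B" using heat_op_one_upper by blast
  define g where "g n = indicat_real (ball x0 (real n))" for n
  have g: "g n \<in> L2 M" "g n \<in> borel_measurable M" for n
    unfolding g_def using indicator_L2[OF _ emeasure_ball_finite] by (auto simp: sets_M L2_def)
  have lim: "(\<lambda>n. g n y) \<longlonglongrightarrow> 1" for y
  proof (rule tendsto_eventually)
    obtain N where "dist x0 y < real N" using reals_Archimedean2 by blast
    then show "\<forall>\<^sub>F n in sequentially. g n y = 1"
      unfolding eventually_sequentially g_def by (intro exI[of _ N]) (auto simp: indicator_def)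
  qed
  have L: "(\<lambda>n. heat_op M p u (g n) x) \<longlonglongrightarrow> heat_op M p u (\<lambda>_. 1) x" if "0 < u" for u x
    using that g lim by (intro heat_op_tendsto[where B = 1]) (auto simp: g_def indicator_def)
  have hb: "\<bar>heat_op M p t (g n) y\<bar> \<le> B" for n y
  proof -
    have "0 \<le> heat_op M p t (g n) y" unfolding heat_op_def
      by (intro integral_nonneg_AE AE_I2) (auto simp: kernel_nonneg[OF t] g_def)
    moreover have "heat_op M p t (g n) y \<le> heat_op M p t (\<lambda>_. 1) y" unfolding heat_op_def
      using kernel_integrable[OF t]
      by (intro integral_mono') (auto simp: kernel_nonneg[OF t] g_def indicator_def)
    ultimately show ?thesis using B[OF t, of y] by simp
  qed
  have LL: "(\<lambda>n. heat_op M p s (heat_op M p t (g n)) x) \<longlonglongrightarrow> heat_op M p s (heat_op M p t (\<lambda>_. 1)) x" for x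
    by (rule heat_op_tendsto[OF s _ _ hb L[OF t]]) (auto intro: heat_op_measurable[OF t] g)
  have "AE x in M. \<forall>n. heat_op M p (s + t) (g n) x = heat_op M p s (heat_op M p t (g n)) x"
    using heat_op_semigroup[OF s t g(1)] by (simp add: AE_all_countable)
  then show ?thesis
  proof eventually_elim
    case (elim x)
    then show ?case using L[of "s + t" x] LL[of x] s t by (auto intro: LIMSEQ_unique)
  qed
qed

text \<open>For functions bounded by one everywhere the essential supremum is at most one, so the
  norm disappears from the weak Bakry--Emery bound.\<close>

lemma heat_op_holder:
  assumes "wBE M p d\<^sub>W \<kappa>"
  obtains C where "0 < C"
    "\<And>t g x y. 0 < t \<Longrightarrow> g \<in> borel_measurable M \<Longrightarrow> (\<And>z. \<bar>g z\<bar> \<le> 1) \<Longrightarrow>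
      \<bar>heat_op M p t g x - heat_op M p t g y\<bar> \<le> C * (dist x y powr \<kappa> / t powr (\<kappa> / d\<^sub>W))"
proof -
  obtain C where C: "0 < C" "\<And>t g x y. 0 < t \<Longrightarrow> g \<in> Linf M \<Longrightarrow>
      \<bar>heat_op M p t g x - heat_op M p t g y\<bar> \<le> C * (dist x y powr \<kappa> / t powr (\<kappa> / d\<^sub>W)) * Linf_norm M g"
    using assms unfolding wBE_def by blast
  show thesis
  proof (rule that[OF C(1)])
    fix t :: real and g :: "'a \<Rightarrow> real" and x y
    assume t: "0 < t" and [measurable]: "g \<in> borel_measurable M" and g: "\<And>z. \<bar>g z\<bar> \<le> 1"
    have e: "esssup M (\<lambda>x. ereal \<bar>g x\<bar>) \<le> ereal 1"
      using g by (intro esssup_I) auto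
    then have "g \<in> Linf M" unfolding Linf_def by auto
    moreover have "Linf_norm M g \<le> 1"
      using e unfolding Linf_norm_def by (cases "esssup M (\<lambda>x. ereal \<bar>g x\<bar>)") auto
    ultimately show "\<bar>heat_op M p t g x - heat_op M p t g y\<bar> \<le> C * (dist x y powr \<kappa> / t powr (\<kappa> / d\<^sub>W))"
      using C(1) by (intro order_trans[OF C(2)[OF t]] mult_left_le) auto
  qed
qed

text \<open>
  The weak Bakry--Emery bound makes \<open>P\<^sub>t 1\<close> asymptotically constant as \<open>t \<rightarrow> \<infinity>\<close>, so
  \<open>P\<^sub>s 1\<close> is a constant \<open>q s\<close> by the semigroup property. Then \<open>q\<close> is multiplicative and
  bounded above and below by positive constants, which leaves only \<open>q = 1\<close>.
\<close>

lemma heat_op_one: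
  assumes wBE: "wBE M p d\<^sub>W \<kappa>" and s: "0 < s"
  shows "heat_op M p s (\<lambda>_. 1) x = 1"
proof -
  let ?m = "\<lambda>t. heat_op M p t (\<lambda>_. 1)"
  have \<kappa>: "0 < \<kappa>" "\<kappa> < d\<^sub>W" using wBE by (auto simp: wBE_def)
  obtain B where B: "\<And>t x. 0 < t \<Longrightarrow> ?m t x \<le> B" using heat_op_one_upper by blast
  obtain e where e: "0 < e" "\<And>t x. 0 < t \<Longrightarrow> e \<le> ?m t x" using heat_op_one_lower by blast
  have mb: "\<bar>?m t x\<bar> \<le> B" if "0 < t" for t x using B[OF that, of x] e(1) e(2)[OF that, of x] by simp
  have mm[measurable]: "0 < t \<Longrightarrow> ?m t \<in> borel_measurable M" for t by (rule heat_op_measurable) auto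
  obtain C where C: "0 < C" "\<And>t x y. 0 < t \<Longrightarrow> \<bar>?m t x - ?m t y\<bar> \<le> C * (dist x y powr \<kappa> / t powr (\<kappa> / d\<^sub>W))"
  proof -
    obtain C where "0 < C" "\<And>t g x y. 0 < t \<Longrightarrow> g \<in> borel_measurable M \<Longrightarrow> (\<And>z. \<bar>g z\<bar> \<le> 1) \<Longrightarrow>
      \<bar>heat_op M p t g x - heat_op M p t g y\<bar> \<le> C * (dist x y powr \<kappa> / t powr (\<kappa> / d\<^sub>W))"
      using heat_op_holder[OF wBE] by blast
    then show thesis by (intro that[of C]) auto
  qed
  have osc: "(\<lambda>n. ?m (u + real (Suc n)) x - ?m (u + real (Suc n)) y) \<longlonglongrightarrow> 0" if "0 \<le> u" for u x y
  proof (rule Lim_null_comparison)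
    show "\<forall>\<^sub>F n in sequentially. norm (?m (u + real (Suc n)) x - ?m (u + real (Suc n)) y)
        \<le> C * (dist x y powr \<kappa> / (u + real (Suc n)) powr (\<kappa> / d\<^sub>W))"
      using that by (intro always_eventually allI) (simp only: real_norm_def, intro C(2), simp)
    show "(\<lambda>n. C * (dist x y powr \<kappa> / (u + real (Suc n)) powr (\<kappa> / d\<^sub>W))) \<longlonglongrightarrow> 0"
    proof -
      have "0 < \<kappa> / d\<^sub>W" using \<kappa> by simp
      then show ?thesis by real_asymp
    qed
  qed
  have const: "\<exists>q. AE x in M. ?m s x = q" if s: "0 < s" for s
  proof -
    let ?G = "\<lambda>x. \<forall>n. ?m (s + real (Suc n)) x = heat_op M p s (?m (real (Suc n))) x"
    have AE: "AE x in M. ?G x"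
      using heat_op_one_semigroup[OF s] by (simp add: AE_all_countable del: of_nat_Suc)
    \<comment> \<open>At such a point the difference is the operator at time \<open>s\<close>
      applied to \<open>?m (real (Suc n))\<close> minus its value at \<open>x\<close>. This function
      tends to zero by \<open>osc\<close>, so dominated convergence applies.\<close>
    have lim: "(\<lambda>n. ?m (s + real (Suc n)) x - ?m (real (Suc n)) x * ?m s x) \<longlonglongrightarrow> 0" if "?G x" for x
    proof -
      have "(\<lambda>n. heat_op M p s (\<lambda>z. ?m (real (Suc n)) z - ?m (real (Suc n)) x) x) \<longlonglongrightarrow> heat_op M p s (\<lambda>_. 0) x"
      proof (rule heat_op_tendsto[OF s, where B = "B + B"])
        show "\<bar>?m (real (Suc n)) z - ?m (real (Suc n)) x\<bar> \<le> B + B" for n z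
          using mb[of "real (Suc n)" z] mb[of "real (Suc n)" x] by simp
        show "(\<lambda>n. ?m (real (Suc n)) z - ?m (real (Suc n)) x) \<longlonglongrightarrow> 0" for z
          using osc[of 0 z x] by simp
      qed auto
      moreover have "heat_op M p s (\<lambda>z. ?m (real (Suc n)) z - ?m (real (Suc n)) x) x =
          ?m (s + real (Suc n)) x - ?m (real (Suc n)) x * ?m s x" for n
      proof -
        note [measurable] = kernel_measurable2[OF s]
        have [measurable]: "?m (real (Suc n)) \<in> borel_measurable M" by (rule mm) simp
        have "integrable M (\<lambda>z. p s x z * ?m (real (Suc n)) z)"
        proof (rule Bochner_Integration.integrable_bound[OF integrable_mult_right[OF kernel_integrable[OF s, of x], of B]])
          show "AE z in M. norm (p s x z * ?m (real (Suc n)) z) \<le> norm (B * p s x z)"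
          proof (rule AE_I2)
            fix z
            have "\<bar>?m (real (Suc n)) z\<bar> * p s x z \<le> \<bar>B\<bar> * p s x z"
              using mb[of "real (Suc n)" z] by (intro mult_right_mono kernel_nonneg[OF s]) auto
            then show "norm (p s x z * ?m (real (Suc n)) z) \<le> norm (B * p s x z)"
              by (simp only: real_norm_def abs_mult abs_of_nonneg[OF kernel_nonneg[OF s]] mult.commute)
          qed
        qed simp
        then have "heat_op M p s (\<lambda>z. ?m (real (Suc n)) z - ?m (real (Suc n)) x) x =
            heat_op M p s (?m (real (Suc n))) x - ?m (real (Suc n)) x * ?m s x"
          unfolding heat_op_def[of M p s] using kernel_integrable[OF s, of x]
          by (simp add: right_diff_distrib mult.commute[of "p s x _" "heat_op _ _ _ _ x"])
        then show ?thesis using that by simp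
      qed
      ultimately show ?thesis by (simp add: heat_op_def[of M p s "\<lambda>_. 0"])
    qed
    \<comment> \<open>Combining \<open>lim\<close> at both points with \<open>osc\<close> at the
      times \<open>n + 1\<close> and \<open>s + n + 1\<close> shows that
      \<open>?mx n * (?m s x - ?m s y)\<close> tends to zero; since \<open>?mx n\<close> stays above
      \<open>e\<close>, the second factor vanishes.\<close>
    have eq: "?m s x = ?m s y" if "?G x" "?G y" for x y
    proof -
      let ?mx = "\<lambda>n. ?m (real (Suc n)) x" and ?my = "\<lambda>n. ?m (real (Suc n)) y"
      have "(\<lambda>n. - (?m (s + real (Suc n)) x - ?mx n * ?m s x)
          + (?m (s + real (Suc n)) x - ?m (s + real (Suc n)) y)
          + (?m (s + real (Suc n)) y - ?my n * ?m s y)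
          - (?m (0 + real (Suc n)) x - ?m (0 + real (Suc n)) y) * ?m s y) \<longlonglongrightarrow> - 0 + 0 + 0 - 0 * ?m s y"
        using s by (intro tendsto_intros lim osc that) auto
      then have l: "(\<lambda>n. \<bar>?mx n * (?m s x - ?m s y)\<bar> / e) \<longlonglongrightarrow> \<bar>0\<bar> / e"
        using e(1) by (intro tendsto_intros) (simp_all add: algebra_simps)
      have le: "\<bar>?m s x - ?m s y\<bar> \<le> \<bar>?mx n * (?m s x - ?m s y)\<bar> / e" for n
      proof -
        have "e * \<bar>?m s x - ?m s y\<bar> \<le> ?mx n * \<bar>?m s x - ?m s y\<bar>"
          by (intro mult_right_mono e(2)) auto
        moreover have "0 \<le> ?mx n" using e(1) e(2)[of "real (Suc n)" x] by simp
        ultimately show ?thesis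
          using e(1) by (simp only: abs_mult abs_of_nonneg pos_le_divide_eq mult.commute)
      qed
      have "\<bar>?m s x - ?m s y\<bar> \<le> \<bar>0\<bar> / e"
        by (rule LIMSEQ_le_const[OF l]) (use le in blast)
      then show ?thesis by simp
    qed
    have "\<exists>x. ?G x"
      by (rule AE_ex[OF AE])
    then obtain x0 where x0: "?G x0" by blast
    have "AE x in M. ?m s x = ?m s x0" by (rule AE_mp[OF AE]) (intro AE_I2 impI eq x0)
    then show ?thesis by blast
  qed
  have const': "\<exists>q. \<forall>x. ?m s x = q" if s: "0 < s" for s
  proof -
    obtain q where q: "AE x in M. ?m s x = q" using const[OF s] by blast
    \<comment> \<open>The Hoelder bound gives continuity, which upgrades equality almost everywhere
      to equality everywhere.\<close>
    have "continuous_on UNIV (?m s)"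
    proof (clarsimp simp: continuous_on_eq_continuous_at isCont_def)
      fix x
      show "?m s \<midarrow>x\<rightarrow> ?m s x"
      proof (rule LIM_zero_cancel, rule Lim_null_comparison)
        show "\<forall>\<^sub>F y in at x. norm (?m s y - ?m s x) \<le> C * (dist y x powr \<kappa> / s powr (\<kappa> / d\<^sub>W))"
          using C(2)[OF s] by simp
        have "((\<lambda>y. C * (dist y x powr \<kappa> / s powr (\<kappa> / d\<^sub>W))) \<longlongrightarrow> C * (dist x x powr \<kappa> / s powr (\<kappa> / d\<^sub>W))) (at x)"
          using \<kappa> s by (intro tendsto_intros tendsto_powr') auto
        then show "(\<lambda>y. C * (dist y x powr \<kappa> / s powr (\<kappa> / d\<^sub>W))) \<midarrow>x\<rightarrow> 0" by simp
      qed
    qed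
    then have "closed {x. ?m s x = q}" by (intro closed_Collect_eq) auto
    from AE_closed_imp_all[OF this q] show ?thesis by blast
  qed
  have "\<forall>t. \<exists>q. 0 < t \<longrightarrow> (\<forall>x. ?m t x = q)" using const' by blast
  then obtain q where "\<And>t x. 0 < t \<Longrightarrow> ?m t x = q t" by (atomize_elim, unfold choice_iff) blast
  then have q: "?m t = (\<lambda>_. q t)" if "0 < t" for t using that by blast
  have mult: "q (s + t) = q s * q t" if "0 < s" "0 < t" for s t
  proof (rule ccontr)
    assume neq: "q (s + t) \<noteq> q s * q t"
    have "heat_op M p s (\<lambda>_. q t) x = q t * ?m s x" for x by (simp add: heat_op_def mult.commute)
    then have "heat_op M p s (?m t) x = q s * q t" for x using q that by (simp add: mult.commute)
    then show False
      using AE_ex[OF heat_op_one_semigroup[OF that]] q[of "s + t"] that neq by simp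
  qed
  have pow: "q (real (Suc n) * s) = q s ^ Suc n" for n
  proof (induction n)
    case (Suc n)
    have "q (real (Suc (Suc n)) * s) = q (s + real (Suc n) * s)" by (simp add: algebra_simps)
    also have "\<dots> = q s * q (real (Suc n) * s)" using s by (intro mult) auto
    finally show ?case using Suc by simp
  qed simp
  have qb: "e \<le> q t" "q t \<le> B" if "0 < t" for t
    using e(2)[OF that, of undefined] B[OF that, of undefined] by (simp_all add: q[OF that])
  have bnd: "e \<le> q s ^ Suc n" "q s ^ Suc n \<le> B" for n
    using qb[of "real (Suc n) * s"] s unfolding pow by auto
  have "q s = 1"
  proof (rule ccontr)
    assume "q s \<noteq> 1"
    then consider "q s > 1" | "q s < 1" by linarith
    then show False
    proof cases
      case 1
      then obtain n where "B < q s ^ n" using real_arch_pow by blast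
      also have "\<dots> \<le> q s ^ Suc n" using 1 by (intro power_increasing) auto
      finally show False using bnd(2)[of n] by simp
    next
      case 2
      then obtain n where "q s ^ n < e" using real_arch_pow_inv e(1) by blast
      moreover have "q s ^ Suc n \<le> q s ^ n" using 2 e(1) qb(1)[OF s] by (intro power_decreasing) auto
      ultimately show False using bnd(1)[of n] by simp
    qed
  qed
  then show ?thesis using q[OF s] by simp
qed

lemma symmetric_markov_kernel_heat:
  assumes wBE: "wBE M p d\<^sub>W \<kappa>" and t: "0 < t"
  shows "symmetric_markov_kernel M (p t)"
proof
  show "(\<lambda>(x, y). p t x y) \<in> borel_measurable (M \<Otimes>\<^sub>M M)" by (rule kernel_measurable[OF t])
  show "0 \<le> p t x y" "p t x y = p t y x" for x y by (rule kernel_nonneg[OF t] kernel_sym[OF t])+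
  show "(\<integral>\<^sup>+y. ennreal (p t x y) \<partial>M) = 1" for x
    using heat_op_one[OF wBE t, of x] kernel_integrable[OF t, of x] kernel_nonneg[OF t]
    by (simp add: nn_integral_eq_integral heat_op_def)
qed

end

subsection \<open>Comparison of energies\<close>

text \<open>The Dirichlet form is left behind here and all constants are fixed: the comparison of
  energies works from the kernel bounds, symmetry, unit mass, the semigroup law for sets of finite
  measure and the Hoelder bound.\<close>

locale sub_gaussian_semigroup = sigma_finite_measure M
  for M :: "'a::metric_space measure" +
  fixes p :: "real \<Rightarrow> 'a \<Rightarrow> 'a \<Rightarrow> real"
    and d\<^sub>H d\<^sub>W \<kappa> c1 c2 c3 c4 c5 c6 C :: real
  assumes sets_M [measurable_cong]: "sets M = sets borel"
    and dist_measurable: "(\<lambda>(x, y). dist x y) \<in> borel_measurable (M \<Otimes>\<^sub>M M)"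
    and kernel: "0 < t \<Longrightarrow> symmetric_markov_kernel M (p t)"
    and params: "0 < d\<^sub>H" "2 < d\<^sub>W" "0 < \<kappa>" "\<kappa> < d\<^sub>W"
    and const_pos: "0 < c1" "0 < c2" "0 < c3" "0 < c4" "0 < c5" "0 < c6" "0 < C"
    and ball_lower: "0 \<le> r \<Longrightarrow> c1 * r powr d\<^sub>H \<le> measure M (ball x r)"
    and ball_upper: "0 \<le> r \<Longrightarrow> measure M (ball x r) \<le> c2 * r powr d\<^sub>H"
    and lower: "0 < t \<Longrightarrow>
      c5 * t powr (- d\<^sub>H / d\<^sub>W) * exp (- c6 * (dist x y powr d\<^sub>W / t) powr (1 / (d\<^sub>W - 1))) \<le> p t x y"
    and upper: "0 < t \<Longrightarrow>
      p t x y \<le> c3 * t powr (- d\<^sub>H / d\<^sub>W) * exp (- c4 * (dist x y powr d\<^sub>W / t) powr (1 / (d\<^sub>W - 1)))"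
    and semigroup: "A \<in> sets M \<Longrightarrow> emeasure M A < \<infinity> \<Longrightarrow> 0 < s \<Longrightarrow> 0 < t \<Longrightarrow>
      AE x in M. heat_op M p (s + t) (indicat_real A) x = heat_op M p s (heat_op M p t (indicat_real A)) x"
    and holder: "0 < t \<Longrightarrow> g \<in> borel_measurable M \<Longrightarrow> (\<And>z. \<bar>g z\<bar> \<le> 1) \<Longrightarrow>
      \<bar>heat_op M p t g x - heat_op M p t g y\<bar> \<le> C * (dist x y powr \<kappa> / t powr (\<kappa> / d\<^sub>W))"
begin

sublocale pair: pair_sigma_finite M M ..

lemma space_M [simp]: "space M = UNIV"
  using sets_eq_imp_space_eq[OF sets_M] by simp

lemma dist_measurable' [measurable (raw)]:
  "f \<in> N \<rightarrow>\<^sub>M M \<Longrightarrow> g \<in> N \<rightarrow>\<^sub>M M \<Longrightarrow> (\<lambda>z. dist (f z) (g z)) \<in> borel_measurable N"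
  using measurable_compose[OF measurable_Pair dist_measurable] by simp

lemma measure_ball_measurable [measurable]: "(\<lambda>x. measure M (ball x r)) \<in> borel_measurable M"
proof -
  have "measure M (ball x r) = enn2real (\<integral>\<^sup>+y. (if dist x y < r then 1 else 0) \<partial>M)" for x
    using nn_integral_indicator[of "ball x r" M]
    by (simp add: sets_M measure_def indicator_def of_bool_def)
  then show ?thesis by simp
qed

lemma kernel_measurable:
  assumes "0 < t" "f \<in> N \<rightarrow>\<^sub>M M" "g \<in> N \<rightarrow>\<^sub>M M"
  shows "(\<lambda>z. p t (f z) (g z)) \<in> borel_measurable N"
  by (rule symmetric_markov_kernel.kernel_measurable'[OF kernel]) fact+

lemma kernel_nonneg: "0 < t \<Longrightarrow> 0 \<le> p t x y"
  by (rule symmetric_markov_kernel.kernel_nonneg[OF kernel])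

lemma double_nn_integral_le_cmult:
  fixes F G :: "'a \<Rightarrow> 'a \<Rightarrow> ennreal"
  assumes [measurable]: "(\<lambda>(x, y). G x y) \<in> borel_measurable (M \<Otimes>\<^sub>M M)"
    and "\<And>x y. F x y \<le> c * G x y"
  shows "(\<integral>\<^sup>+x. \<integral>\<^sup>+y. F x y \<partial>M \<partial>M) \<le> c * (\<integral>\<^sup>+x. \<integral>\<^sup>+y. G x y \<partial>M \<partial>M)"
proof -
  have "(\<integral>\<^sup>+x. \<integral>\<^sup>+y. F x y \<partial>M \<partial>M) \<le> (\<integral>\<^sup>+x. \<integral>\<^sup>+y. c * G x y \<partial>M \<partial>M)"
    by (intro nn_integral_mono assms(2))
  also have "\<dots> = c * (\<integral>\<^sup>+x. \<integral>\<^sup>+y. G x y \<partial>M \<partial>M)"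
    by (simp add: nn_integral_cmult)
  finally show ?thesis .
qed

text \<open>For the indicator of a set this is the function \<open>h\<close> of the outline.\<close>

definition heat_energy :: "real \<Rightarrow> ('a \<Rightarrow> real) \<Rightarrow> ennreal" where
  "heat_energy t f = (\<integral>\<^sup>+x. \<integral>\<^sup>+y. ennreal (p t x y * \<bar>f x - f y\<bar>) \<partial>M \<partial>M)"

lemma heat_energy_integrand_measurable:
  assumes "0 < t" and [measurable]: "f \<in> borel_measurable M"
  shows "(\<lambda>(x, y). ennreal (p t x y * \<bar>f x - f y\<bar>)) \<in> borel_measurable (M \<Otimes>\<^sub>M M)"
proof -
  note [measurable] = kernel_measurable[OF assms(1)]
  show ?thesis by measurable
qed

lemma KS_integrand_measurable [measurable]:
  assumes [measurable]: "f \<in> borel_measurable M"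
  shows "(\<lambda>(x, y). ennreal (\<bar>f y - f x\<bar> / (r powr l * measure M (ball x r))) * indicator (ball x r) y)
    \<in> borel_measurable (M \<Otimes>\<^sub>M M)"
  unfolding indicator_def mem_ball by measurable

section \<open>Off-diagonal decay of the kernel\<close>

text \<open>The lower bound at a later time \<open>N * t\<close> decays more slowly in the distance
  than the upper bound at \<open>t\<close>. Once
  \<open>c6 / real N powr \<beta> \<le> c4 / 2\<close>, it accounts for one half of the exponent,
  and the other half is left over as a gain.\<close>

lemma kernel_dilation:
  obtains N :: nat and C0 where "1 \<le> N" "0 < C0"
    "\<And>t x y. 0 < t \<Longrightarrow> p t x y \<le>
      C0 * p (real N * t) x y * exp (- (c4 / 2) * (dist x y powr d\<^sub>W / t) powr (1 / (d\<^sub>W - 1)))"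
proof -
  define \<beta> where "\<beta> = 1 / (d\<^sub>W - 1)"
  have \<beta>: "0 < \<beta>" using params by (simp add: \<beta>_def)
  obtain N :: nat where N: "max 1 ((2 * c6 / c4) powr (1 / \<beta>)) \<le> real N"
    using real_arch_simple by blast
  then have N1: "1 \<le> N" by simp
  have "((2 * c6 / c4) powr (1 / \<beta>)) powr \<beta> \<le> real N powr \<beta>"
    using N \<beta> by (intro powr_mono2) auto
  then have "2 * c6 / c4 \<le> real N powr \<beta>" using \<beta> const_pos by (simp add: powr_powr)
  then have c6N: "c6 / real N powr \<beta> \<le> c4 / 2"
    using const_pos N1 by (simp add: field_simps)
  define C0 where "C0 = c3 / c5 * real N powr (d\<^sub>H / d\<^sub>W)"
  show thesis
  proof (rule that[OF N1])
    show "0 < C0" using const_pos N1 by (simp add: C0_def)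
    fix t :: real and x y :: 'a assume t: "0 < t"
    define w where "w = (dist x y powr d\<^sub>W / t) powr \<beta>"
    have w: "0 \<le> w" by (simp add: w_def)
    have "(dist x y powr d\<^sub>W / (real N * t)) powr \<beta> = w / real N powr \<beta>"
      unfolding w_def using t N1 by (simp add: powr_divide powr_mult)
    then have lo: "c5 * (real N * t) powr (- d\<^sub>H / d\<^sub>W) * exp (- c6 * (w / real N powr \<beta>)) \<le> p (real N * t) x y"
      using lower[of "real N * t" x y] t N1 by (simp add: \<beta>_def)
    have "c6 * (w / real N powr \<beta>) \<le> c4 / 2 * w"
      using mult_right_mono[OF c6N w] by simp
    then have "c5 * (real N * t) powr (- d\<^sub>H / d\<^sub>W) * exp (- (c4 / 2) * w) \<le> p (real N * t) x y"
      using const_pos by (intro order_trans[OF _ lo] mult_left_mono) auto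
    then have "C0 * (c5 * (real N * t) powr (- d\<^sub>H / d\<^sub>W) * exp (- (c4 / 2) * w)) * exp (- (c4 / 2) * w)
        \<le> C0 * p (real N * t) x y * exp (- (c4 / 2) * w)"
      using \<open>0 < C0\<close> by (intro mult_right_mono mult_left_mono) auto
    moreover have "C0 * (c5 * (real N * t) powr (- d\<^sub>H / d\<^sub>W) * exp (- (c4 / 2) * w)) * exp (- (c4 / 2) * w)
        = c3 * t powr (- d\<^sub>H / d\<^sub>W) * (exp (- (c4 / 2) * w) * exp (- (c4 / 2) * w))"
      using const_pos N1 t unfolding C0_def by (simp add: powr_mult powr_minus field_simps)
    moreover have "exp (- (c4 / 2) * w) * exp (- (c4 / 2) * w) = exp (- c4 * w)"
      by (simp flip: exp_add)
    moreover have "p t x y \<le> c3 * t powr (- d\<^sub>H / d\<^sub>W) * exp (- c4 * w)"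
      using upper[OF t, of x y] by (simp add: w_def \<beta>_def)
    ultimately have "p t x y \<le> C0 * p (real N * t) x y * exp (- (c4 / 2) * w)" by (metis order_trans)
    then show "p t x y \<le> C0 * p (real N * t) x y * exp (- (c4 / 2) * (dist x y powr d\<^sub>W / t) powr (1 / (d\<^sub>W - 1)))"
      by (simp only: w_def \<beta>_def)
  qed
qed

text \<open>The decay gained in \<open>kernel_dilation\<close> absorbs the power of the distance, at
  the price of passing to the time \<open>N * t\<close>.\<close>

lemma kernel_moment:
  obtains N :: nat and C0 where "1 \<le> N" "0 < C0"
    "\<And>t x y. 0 < t \<Longrightarrow> p t x y * dist x y powr \<kappa> \<le> C0 * t powr (\<kappa> / d\<^sub>W) * p (real N * t) x y"
proof -
  obtain N C0 where N: "1 \<le> N" "0 < C0" "\<And>t x y. 0 < t \<Longrightarrow> p t x y \<le>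
      C0 * p (real N * t) x y * exp (- (c4 / 2) * (dist x y powr d\<^sub>W / t) powr (1 / (d\<^sub>W - 1)))"
    using kernel_dilation by metis
  \<comment> \<open>Chosen so that \<open>w powr e\<close> equals
    \<open>dist x y powr \<kappa> / t powr (\<kappa> / d\<^sub>W)\<close>.\<close>
  define e where "e = \<kappa> / d\<^sub>W * (d\<^sub>W - 1)"
  have e: "0 < e" using params by (simp add: e_def)
  define C1 where "C1 = (e / (c4 / 2)) powr e"
  show thesis
  proof (rule that[of N "C0 * C1"])
    show "1 \<le> N" by fact
    show "0 < C0 * C1" using N const_pos e by (simp add: C1_def)
    fix t :: real and x y :: 'a assume t: "0 < t"
    define w where "w = (dist x y powr d\<^sub>W / t) powr (1 / (d\<^sub>W - 1))"
    have we: "w powr e \<le> C1 * exp (c4 / 2 * w)"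
      unfolding C1_def using e const_pos by (intro powr_le_exp) (auto simp: w_def)
    have "w powr e = (dist x y powr d\<^sub>W / t) powr (\<kappa> / d\<^sub>W)"
      using params by (simp add: w_def powr_powr e_def)
    also have "\<dots> = dist x y powr \<kappa> / t powr (\<kappa> / d\<^sub>W)"
      using params t by (simp add: powr_divide powr_powr)
    finally have d: "dist x y powr \<kappa> = t powr (\<kappa> / d\<^sub>W) * w powr e" using t by simp
    have "p t x y * dist x y powr \<kappa> \<le> (C0 * p (real N * t) x y * exp (- (c4 / 2) * w)) * (t powr (\<kappa> / d\<^sub>W) * w powr e)"
      unfolding d using N(3)[OF t, of x y] by (intro mult_right_mono) (auto simp: w_def)
    also have "\<dots> \<le> (C0 * p (real N * t) x y * exp (- (c4 / 2) * w)) * (t powr (\<kappa> / d\<^sub>W) * (C1 * exp (c4 / 2 * w)))"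
      using we N t kernel_nonneg[of "real N * t" x y] by (intro mult_left_mono) auto
    also have "\<dots> = C0 * C1 * t powr (\<kappa> / d\<^sub>W) * p (real N * t) x y"
      by (simp add: exp_minus field_simps)
    finally show "p t x y * dist x y powr \<kappa> \<le> C0 * C1 * t powr (\<kappa> / d\<^sub>W) * p (real N * t) x y" .
  qed
qed

end

section \<open>The heat flow of an indicator function\<close>

locale sub_gaussian_semigroup_set = sub_gaussian_semigroup +
  fixes A
  assumes A_meas [measurable]: "A \<in> sets M" and A_fin: "emeasure M A < \<infinity>"
begin

abbreviation "ind \<equiv> indicat_real A"
abbreviation "u t \<equiv> heat_op M p t ind"

lemma integrable_ind: "integrable M ind"
  using A_fin by (simp add: less_top[symmetric])

lemma integrable_heat_op: "0 < t \<Longrightarrow> integrable M w \<Longrightarrow> integrable M (heat_op M p t w)"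
  unfolding heat_op_def by (rule symmetric_markov_kernel.integrable_kernel_op[OF kernel])

lemma heat_energy_eq_norm:
  "0 < t \<Longrightarrow> heat_energy t ind = (\<integral>\<^sup>+x. ennreal \<bar>ind x - u t x\<bar> \<partial>M)"
  unfolding heat_energy_def heat_op_def
  by (rule symmetric_markov_kernel.nn_integral_indicator_minus_kernel_op[OF kernel A_meas, symmetric])

lemma heat_energy_finite:
  assumes "0 < t"
  shows "heat_energy t ind < \<infinity>"
  unfolding heat_energy_eq_norm[OF assms]
  using Bochner_Integration.integrable_diff[OF integrable_ind integrable_heat_op[OF assms integrable_ind]]
  by (simp add: integrable_iff_bounded)

text \<open>Linearity of the integral needs both products to be integrable in \<open>y\<close>,
  which Fubini's theorem supplies for almost every \<open>x\<close>.\<close>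

lemma heat_op_diff:
  assumes t: "0 < t" and "integrable M v" "integrable M w"
  shows "AE x in M. heat_op M p t (\<lambda>y. v y - w y) x = heat_op M p t v x - heat_op M p t w x"
proof -
  have int: "AE x in M. integrable M (\<lambda>y. p t x y * v y)" if "integrable M v" for v
    using pair.AE_integrable_fst[OF symmetric_markov_kernel.integrable_kernel_snd[OF kernel[OF t] that
      borel_measurable_const[of 1], of 1, simplified]] by simp
  show ?thesis
    using int[OF assms(2)] int[OF assms(3)]
    by eventually_elim (simp add: heat_op_def right_diff_distrib)
qed

lemma norm_diff_triangle:
  assumes [measurable]: "f \<in> borel_measurable M" "g \<in> borel_measurable M" "h \<in> borel_measurable M"
  shows "(\<integral>\<^sup>+x. ennreal \<bar>f x - h x\<bar> \<partial>M) \<le>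
    (\<integral>\<^sup>+x. ennreal \<bar>f x - g x\<bar> \<partial>M) + (\<integral>\<^sup>+x. ennreal \<bar>g x - h x\<bar> \<partial>M)"
  by (subst nn_integral_add[symmetric])
     (auto simp flip: ennreal_plus intro!: nn_integral_mono ennreal_leI)

lemma heat_op_increment:
  assumes s: "0 < s" and t: "0 < t"
  shows "AE x in M. u s x - u (s + t) x = heat_op M p s (\<lambda>y. ind y - u t y) x"
  using heat_op_diff[OF s integrable_ind integrable_heat_op[OF t integrable_ind]] semigroup[OF A_meas A_fin s t]
  by eventually_elim simp

lemma u_measurable [measurable]: "0 < t \<Longrightarrow> u t \<in> borel_measurable M"
  using integrable_heat_op[OF _ integrable_ind] by blast

text \<open>Insert \<open>u s\<close> between \<open>ind\<close> and \<open>u (s + t)\<close>. The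
  second difference is the operator at time \<open>s\<close> applied to \<open>ind - u t\<close>,
  and the contraction property bounds its norm by the heat energy at \<open>t\<close>.\<close>

lemma heat_energy_add_le:
  assumes s: "0 < s" and t: "0 < t"
  shows "heat_energy (s + t) ind \<le> heat_energy s ind + heat_energy t ind"
proof -
  have [measurable]: "u s \<in> borel_measurable M" "u t \<in> borel_measurable M" "u (s + t) \<in> borel_measurable M"
    using s t by simp_all
  have "heat_energy (s + t) ind \<le> heat_energy s ind + (\<integral>\<^sup>+x. ennreal \<bar>u s x - u (s + t) x\<bar> \<partial>M)"
    using s t by (simp add: heat_energy_eq_norm norm_diff_triangle)
  also have "(\<integral>\<^sup>+x. ennreal \<bar>u s x - u (s + t) x\<bar> \<partial>M) = (\<integral>\<^sup>+x. ennreal \<bar>heat_op M p s (\<lambda>y. ind y - u t y) x\<bar> \<partial>M)"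
    using heat_op_increment[OF s t] by (intro nn_integral_cong_AE) (auto elim: AE_mp)
  also have "\<dots> \<le> heat_energy t ind"
    unfolding heat_energy_eq_norm[OF t] heat_op_def[of M p s]
    by (intro symmetric_markov_kernel.kernel_op_contraction[OF kernel[OF s]]
        Bochner_Integration.integrable_diff integrable_ind integrable_heat_op t)
  finally show ?thesis by (simp add: add_left_mono)
qed

lemma heat_energy_mult_le:
  assumes t: "0 < t"
  shows "heat_energy (real (Suc n) * t) ind \<le> ennreal (real (Suc n)) * heat_energy t ind"
proof (induction n)
  case (Suc n)
  have "heat_energy (real (Suc (Suc n)) * t) ind \<le> heat_energy (real (Suc n) * t) ind + heat_energy t ind"
  proof -
    have "real (Suc (Suc n)) * t = real (Suc n) * t + t" by (simp add: algebra_simps)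
    moreover have "0 < real (Suc n) * t" using t by simp
    ultimately show ?thesis using heat_energy_add_le[OF _ t] by metis
  qed
  also have "\<dots> \<le> ennreal (real (Suc n)) * heat_energy t ind + ennreal 1 * heat_energy t ind"
    using Suc by (intro add_mono) auto
  also have "\<dots> = ennreal (real (Suc (Suc n))) * heat_energy t ind"
    by (subst distrib_right[symmetric], subst ennreal_plus[symmetric]) auto
  finally show ?case .
qed simp

lemma kernel_moment_measurable:
  assumes t: "0 < t"
  shows "(\<lambda>(x, y). ennreal (p t x y * dist x y powr \<kappa> * \<bar>ind x - ind y\<bar>)) \<in> borel_measurable (M \<Otimes>\<^sub>M M)"
proof -
  have "(\<lambda>z. p t (fst z) (snd z) * dist (fst z) (snd z) powr \<kappa> * \<bar>ind (fst z) - ind (snd z)\<bar>)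
      \<in> borel_measurable (M \<Otimes>\<^sub>M M)"
    by (intro borel_measurable_times kernel_measurable[OF t] powr_real_measurable dist_measurable' borel_measurable_abs
        borel_measurable_diff borel_measurable_const measurable_fst measurable_snd
        measurable_compose[OF measurable_fst borel_measurable_indicator[OF A_meas]]
        measurable_compose[OF measurable_snd borel_measurable_indicator[OF A_meas]])
  then show ?thesis by (simp add: case_prod_beta)
qed

text \<open>The duality step: moving the operator at time \<open>s\<close> onto \<open>v\<close> and
  applying the Green formula at time \<open>t\<close> leaves only differences of \<open>V\<close>,
  which the Hoelder bound at time \<open>s\<close> controls.\<close>

lemma heat_op_increment_pairing:
  assumes s: "0 < s" and t: "0 < t" and v[measurable]: "v \<in> borel_measurable M" and v1: "\<And>x. \<bar>v x\<bar> \<le> 1"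
  shows "ennreal \<bar>\<integral>x. (u s x - u (s + t) x) * v x \<partial>M\<bar> \<le>
    ennreal (C / s powr (\<kappa> / d\<^sub>W)) * (\<integral>\<^sup>+x. \<integral>\<^sup>+y. ennreal (p t x y * dist x y powr \<kappa> * \<bar>ind x - ind y\<bar>) \<partial>M \<partial>M)"
proof -
  interpret ks: symmetric_markov_kernel M "p s" by (rule kernel[OF s])
  interpret kt: symmetric_markov_kernel M "p t" by (rule kernel[OF t])
  note [measurable] = kernel_measurable[OF t] kernel_measurable[OF s]
  define V where "V = heat_op M p s v"
  have V[measurable]: "V \<in> borel_measurable M" unfolding V_def heat_op_def by measurable
  have V1: "\<bar>V x\<bar> \<le> 1" for x
    unfolding V_def heat_op_def by (intro ks.kernel_op_bound v v1) simp
  have Vh: "\<bar>V x - V y\<bar> \<le> C * (dist x y powr \<kappa> / s powr (\<kappa> / d\<^sub>W))" for x y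
    unfolding V_def by (intro holder s v v1)
  have int: "integrable M (\<lambda>y. ind y - u t y)"
    by (intro Bochner_Integration.integrable_diff integrable_ind integrable_heat_op t)
  have [measurable]: "u s \<in> borel_measurable M" "u t \<in> borel_measurable M" "u (s + t) \<in> borel_measurable M"
    using s t by simp_all
  have m': "heat_op M p s (\<lambda>y. ind y - u t y) \<in> borel_measurable M"
    using integrable_heat_op[OF s int] by blast
  have "(\<integral>x. (u s x - u (s + t) x) * v x \<partial>M) = (\<integral>x. heat_op M p s (\<lambda>y. ind y - u t y) x * v x \<partial>M)"
    using heat_op_increment[OF s t] m' by (intro integral_cong_AE) auto
  also have "\<dots> = (\<integral>x. (ind x - u t x) * V x \<partial>M)"
    unfolding V_def heat_op_def[of M p s] by (intro ks.kernel_op_adjoint[OF int v v1])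
  also have "\<dots> = (\<integral>(x, y). p t x y * (ind x - ind y) * (V x - V y) \<partial>(M \<Otimes>\<^sub>M M)) / 2"
    unfolding heat_op_def[of M p t] by (intro kt.kernel_op_green(1)[OF integrable_ind V V1])
  finally have eq: "(\<integral>x. (u s x - u (s + t) x) * v x \<partial>M) =
    (\<integral>(x, y). p t x y * (ind x - ind y) * (V x - V y) \<partial>(M \<Otimes>\<^sub>M M)) / 2" .
  have "ennreal \<bar>\<integral>x. (u s x - u (s + t) x) * v x \<partial>M\<bar> \<le>
      ennreal (norm (\<integral>(x, y). p t x y * (ind x - ind y) * (V x - V y) \<partial>(M \<Otimes>\<^sub>M M)))"
    unfolding eq by (intro ennreal_leI) simp
  also have "\<dots> \<le> (\<integral>\<^sup>+z. ennreal (norm (case z of (x, y) \<Rightarrow> p t x y * (ind x - ind y) * (V x - V y))) \<partial>(M \<Otimes>\<^sub>M M))"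
    by (intro integral_norm_bound_ennreal kt.kernel_op_green(2)[OF integrable_ind V V1])
  also have "\<dots> = (\<integral>\<^sup>+x. \<integral>\<^sup>+y. ennreal \<bar>p t x y * (ind x - ind y) * (V x - V y)\<bar> \<partial>M \<partial>M)"
    by (subst nn_integral_fst[symmetric]) (auto simp: case_prod_beta)
  also have "\<dots> \<le> ennreal (C / s powr (\<kappa> / d\<^sub>W)) *
      (\<integral>\<^sup>+x. \<integral>\<^sup>+y. ennreal (p t x y * dist x y powr \<kappa> * \<bar>ind x - ind y\<bar>) \<partial>M \<partial>M)"
  proof (rule double_nn_integral_le_cmult)
    fix x y
    have "\<bar>p t x y * (ind x - ind y) * (V x - V y)\<bar> = p t x y * \<bar>ind x - ind y\<bar> * \<bar>V x - V y\<bar>"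
      by (simp add: abs_mult kernel_nonneg[OF t])
    also have "\<dots> \<le> p t x y * \<bar>ind x - ind y\<bar> * (C * (dist x y powr \<kappa> / s powr (\<kappa> / d\<^sub>W)))"
      by (intro mult_left_mono Vh) (simp add: kernel_nonneg[OF t])
    also have "\<dots> = C / s powr (\<kappa> / d\<^sub>W) * (p t x y * dist x y powr \<kappa> * \<bar>ind x - ind y\<bar>)" by simp
    finally show "ennreal \<bar>p t x y * (ind x - ind y) * (V x - V y)\<bar> \<le> ennreal (C / s powr (\<kappa> / d\<^sub>W)) *
        ennreal (p t x y * dist x y powr \<kappa> * \<bar>ind x - ind y\<bar>)"
      using const_pos by (subst ennreal_mult'[symmetric]) (auto intro: ennreal_leI)
  next
    show "(\<lambda>(x, y). ennreal (p t x y * dist x y powr \<kappa> * \<bar>ind x - ind y\<bar>)) \<in> borel_measurable (M \<Otimes>\<^sub>M M)"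
      by (rule kernel_moment_measurable[OF t])
  qed
  finally show ?thesis .
qed

text \<open>Take the sign of the increment as test function in
  \<open>heat_op_increment_pairing\<close>.\<close>

lemma heat_op_increment_norm:
  assumes s: "0 < s" and t: "0 < t"
  shows "(\<integral>\<^sup>+x. ennreal \<bar>u s x - u (s + t) x\<bar> \<partial>M) \<le>
    ennreal (C / s powr (\<kappa> / d\<^sub>W)) * (\<integral>\<^sup>+x. \<integral>\<^sup>+y. ennreal (p t x y * dist x y powr \<kappa> * \<bar>ind x - ind y\<bar>) \<partial>M \<partial>M)"
proof -
  let ?w = "\<lambda>x. u s x - u (s + t) x"
  have w: "integrable M ?w"
    using s t by (intro Bochner_Integration.integrable_diff integrable_heat_op integrable_ind) auto
  then have [measurable]: "?w \<in> borel_measurable M" by blast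
  have "(\<integral>\<^sup>+x. ennreal \<bar>?w x\<bar> \<partial>M) = ennreal (\<integral>x. \<bar>?w x\<bar> \<partial>M)"
    using w by (intro nn_integral_eq_integral integrable_abs) auto
  also have "(\<integral>x. \<bar>?w x\<bar> \<partial>M) = (\<integral>x. ?w x * sgn (?w x) \<partial>M)"
    by (simp add: abs_sgn mult.commute)
  also have "ennreal \<dots> \<le> ennreal \<bar>\<integral>x. ?w x * sgn (?w x) \<partial>M\<bar>"
    by (intro ennreal_leI) simp
  also have "\<dots> \<le> ennreal (C / s powr (\<kappa> / d\<^sub>W)) *
      (\<integral>\<^sup>+x. \<integral>\<^sup>+y. ennreal (p t x y * dist x y powr \<kappa> * \<bar>ind x - ind y\<bar>) \<partial>M \<partial>M)"
    by (intro heat_op_increment_pairing s t measurable_compose[OF \<open>?w \<in> borel_measurable M\<close> borel_measurable_sgn])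
       (simp add: abs_sgn_eq)
  finally show ?thesis .
qed

end

section \<open>Growth of the heat energy in time and comparison with the Korevaar-Schoen
  energy\<close>

context sub_gaussian_semigroup
begin

text \<open>By \<open>kernel_moment\<close> the power of the distance costs a factor
  \<open>t powr (\<kappa> / d\<^sub>W)\<close> and a passage to time \<open>N * t\<close>, from
  which subadditivity returns to \<open>t\<close> at the cost of a factor \<open>N\<close>.\<close>

lemma heat_op_increment_le:
  obtains C' where "0 < C'"
    "\<And>A s t. A \<in> sets M \<Longrightarrow> emeasure M A < \<infinity> \<Longrightarrow> 0 < s \<Longrightarrow> 0 < t \<Longrightarrow>
      (\<integral>\<^sup>+x. ennreal \<bar>heat_op M p s (indicat_real A) x - heat_op M p (s + t) (indicat_real A) x\<bar> \<partial>M)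
      \<le> ennreal (C' * (t / s) powr (\<kappa> / d\<^sub>W)) * heat_energy t (indicat_real A)"
proof -
  obtain N C0 where N: "1 \<le> N" "0 < C0"
    "\<And>t x y. 0 < t \<Longrightarrow> p t x y * dist x y powr \<kappa> \<le> C0 * t powr (\<kappa> / d\<^sub>W) * p (real N * t) x y"
    using kernel_moment by metis
  obtain n where n: "N = Suc n" using N(1) by (cases N) auto
  show thesis
  proof (rule that[of "C * C0 * real N"])
    show "0 < C * C0 * real N" using N const_pos by simp
    fix A s t assume A: "A \<in> sets M" "emeasure M A < \<infinity>" and s: "0 < (s::real)" and t: "0 < (t::real)"
    interpret sub_gaussian_semigroup_set M p d\<^sub>H d\<^sub>W \<kappa> c1 c2 c3 c4 c5 c6 C A
      by unfold_locales fact+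
    have Nt: "0 < real N * t" using N t by simp
    have "(\<integral>\<^sup>+x. \<integral>\<^sup>+y. ennreal (p t x y * dist x y powr \<kappa> * \<bar>ind x - ind y\<bar>) \<partial>M \<partial>M)
        \<le> ennreal (C0 * t powr (\<kappa> / d\<^sub>W)) * heat_energy (real N * t) ind"
      unfolding heat_energy_def
    proof (rule double_nn_integral_le_cmult)
      show "(\<lambda>(x, y). ennreal (p (real N * t) x y * \<bar>ind x - ind y\<bar>)) \<in> borel_measurable (M \<Otimes>\<^sub>M M)"
        by (rule heat_energy_integrand_measurable[OF Nt]) simp
      fix x y
      have "p t x y * dist x y powr \<kappa> * \<bar>ind x - ind y\<bar> \<le> C0 * t powr (\<kappa> / d\<^sub>W) * p (real N * t) x y * \<bar>ind x - ind y\<bar>"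
        by (intro mult_right_mono N(3)[OF t]) simp
      then show "ennreal (p t x y * dist x y powr \<kappa> * \<bar>ind x - ind y\<bar>) \<le>
          ennreal (C0 * t powr (\<kappa> / d\<^sub>W)) * ennreal (p (real N * t) x y * \<bar>ind x - ind y\<bar>)"
        using N(2) by (subst ennreal_mult'[symmetric]) (auto intro!: ennreal_leI simp: mult.assoc)
    qed
    also have "\<dots> \<le> ennreal (C0 * t powr (\<kappa> / d\<^sub>W)) * (ennreal (real N) * heat_energy t ind)"
      unfolding n by (intro mult_left_mono heat_energy_mult_le t) simp
    finally have "ennreal (C / s powr (\<kappa> / d\<^sub>W)) * (\<integral>\<^sup>+x. \<integral>\<^sup>+y. ennreal (p t x y * dist x y powr \<kappa> * \<bar>ind x - ind y\<bar>) \<partial>M \<partial>M)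
        \<le> ennreal (C / s powr (\<kappa> / d\<^sub>W)) * (ennreal (C0 * t powr (\<kappa> / d\<^sub>W)) * (ennreal (real N) * heat_energy t ind))"
      by (rule mult_left_mono) simp
    also have "\<dots> = ennreal (C * C0 * real N * (t / s) powr (\<kappa> / d\<^sub>W)) * heat_energy t ind"
    proof -
      have "ennreal (C / s powr (\<kappa> / d\<^sub>W)) * (ennreal (C0 * t powr (\<kappa> / d\<^sub>W)) * ennreal (real N))
          = ennreal (C / s powr (\<kappa> / d\<^sub>W) * (C0 * t powr (\<kappa> / d\<^sub>W) * real N))"
        using const_pos N by (simp flip: ennreal_mult'')
      also have "C / s powr (\<kappa> / d\<^sub>W) * (C0 * t powr (\<kappa> / d\<^sub>W) * real N) = C * C0 * real N * (t / s) powr (\<kappa> / d\<^sub>W)"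
        using s t by (simp add: powr_divide)
      finally show ?thesis by (simp only: mult.assoc[symmetric])
    qed
    finally show "(\<integral>\<^sup>+x. ennreal \<bar>u s x - u (s + t) x\<bar> \<partial>M)
      \<le> ennreal (C * C0 * real N * (t / s) powr (\<kappa> / d\<^sub>W)) * heat_energy t ind"
      using order_trans[OF heat_op_increment_norm[OF s t]] by blast
  qed
qed

text \<open>Subadditivity alone gives only the exponent one. Here each further time step, taken at
  time \<open>x * t\<close>, contributes just a multiple of \<open>x powr (b - 1)\<close> with
  \<open>b = 1 - \<kappa> / d\<^sub>W\<close>, and these contributions sum up to order
  \<open>x powr b\<close>.\<close>

lemma heat_energy_scaling:
  obtains C' where "0 < C'"
    "\<And>A t n. A \<in> sets M \<Longrightarrow> emeasure M A < \<infinity> \<Longrightarrow> 0 < t \<Longrightarrow>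
      heat_energy (real (Suc n) * t) (indicat_real A)
      \<le> ennreal (C' * real (Suc n) powr ((d\<^sub>W - \<kappa>) / d\<^sub>W)) * heat_energy t (indicat_real A)"
proof -
  obtain C1 where C1: "0 < C1" "\<And>A s t. A \<in> sets M \<Longrightarrow> emeasure M A < \<infinity> \<Longrightarrow> 0 < s \<Longrightarrow> 0 < t \<Longrightarrow>
      (\<integral>\<^sup>+x. ennreal \<bar>heat_op M p s (indicat_real A) x - heat_op M p (s + t) (indicat_real A) x\<bar> \<partial>M)
      \<le> ennreal (C1 * (t / s) powr (\<kappa> / d\<^sub>W)) * heat_energy t (indicat_real A)"
    by (rule heat_op_increment_le) (rule that)
  define b where "b = (d\<^sub>W - \<kappa>) / d\<^sub>W"
  have b: "0 < b" "b < 1" "\<kappa> / d\<^sub>W = 1 - b" using params by (auto simp: b_def field_simps)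
  \<comment> \<open>The entry \<open>1\<close> covers the base case; the other makes each
    contribution at most the increment of \<open>C' * x powr b\<close>.\<close>
  define C' where "C' = max 1 (2 * C1 / b)"
  have C': "1 \<le> C'" "C1 \<le> C' * (b / 2)"
    using b C1 by (auto simp: C'_def field_simps max_def)
  show thesis
  proof (rule that[of C'], goal_cases)
    case 1
    then show ?case using C' by simp
  next
    case (2 A t n)
    then have A: "A \<in> sets M" "emeasure M A < \<infinity>" and t: "0 < t" by auto
    interpret sub_gaussian_semigroup_set M p d\<^sub>H d\<^sub>W \<kappa> c1 c2 c3 c4 c5 c6 C A
      by unfold_locales fact+
    show ?case unfolding b_def[symmetric]
    proof (induction n)
      case 0
      have "ennreal 1 * heat_energy t ind \<le> ennreal C' * heat_energy t ind"
        using C' by (intro mult_right_mono ennreal_leI) auto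
      then show ?case by simp
    next
      case (Suc n)
      let ?x = "real (Suc n)"
      have x: "1 \<le> ?x" "0 < ?x * t" using t by auto
      have eq: "real (Suc (Suc n)) * t = ?x * t + t" by (simp add: algebra_simps)
      have xt: "0 < ?x * t + t" using x(2) t by (rule add_pos_pos)
      note [measurable] = u_measurable[OF x(2)] u_measurable[OF xt]
      have "heat_energy (?x * t + t) ind \<le> heat_energy (?x * t) ind + (\<integral>\<^sup>+z. ennreal \<bar>u (?x * t) z - u (?x * t + t) z\<bar> \<partial>M)"
        unfolding heat_energy_eq_norm[OF x(2)] heat_energy_eq_norm[OF xt] by (rule norm_diff_triangle) measurable
      also have "\<dots> \<le> ennreal (C' * ?x powr b) * heat_energy t ind + ennreal (C1 * (t / (?x * t)) powr (\<kappa> / d\<^sub>W)) * heat_energy t ind"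
        using Suc C1(2)[OF A x(2) t] by (rule add_mono)
      also have "\<dots> = ennreal (C' * ?x powr b + C1 * (t / (?x * t)) powr (\<kappa> / d\<^sub>W)) * heat_energy t ind"
        using C' C1(1) by (subst ennreal_plus) (auto simp: distrib_right)
      also have "C1 * (t / (?x * t)) powr (\<kappa> / d\<^sub>W) = C1 * ?x powr (b - 1)"
        using t x by (simp add: b(3) powr_divide powr_diff field_simps del: of_nat_Suc)
      also have "ennreal (C' * ?x powr b + C1 * ?x powr (b - 1)) * heat_energy t ind \<le>
          ennreal (C' * (?x + 1) powr b) * heat_energy t ind"
      proof (intro mult_right_mono ennreal_leI)
        have "C1 * ?x powr (b - 1) \<le> C' * (b / 2) * ?x powr (b - 1)"
          using C' by (intro mult_right_mono) auto
        also have "\<dots> = C' * (b / 2 * ?x powr (b - 1))" by simp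
        also have "\<dots> \<le> C' * ((?x + 1) powr b - ?x powr b)"
          using C' b x by (intro mult_left_mono powr_increment_lower) auto
        finally show "C' * ?x powr b + C1 * ?x powr (b - 1) \<le> C' * (?x + 1) powr b"
          by (simp add: algebra_simps)
      qed simp
      finally show ?case unfolding eq by (simp add: add.commute)
    qed
  qed
qed

lemma double_nn_integral_linear:
  fixes G H :: "'a \<Rightarrow> 'a \<Rightarrow> ennreal"
  assumes [measurable]: "(\<lambda>(x, y). G x y) \<in> borel_measurable (M \<Otimes>\<^sub>M M)"
    "(\<lambda>(x, y). H x y) \<in> borel_measurable (M \<Otimes>\<^sub>M M)"
  shows "(\<integral>\<^sup>+x. \<integral>\<^sup>+y. a * G x y + b * H x y \<partial>M \<partial>M) =
    a * (\<integral>\<^sup>+x. \<integral>\<^sup>+y. G x y \<partial>M \<partial>M) + b * (\<integral>\<^sup>+x. \<integral>\<^sup>+y. H x y \<partial>M \<partial>M)"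
  by (simp add: nn_integral_add nn_integral_cmult)

text \<open>
  The tail of the heat energy at time \<open>t\<close> is at most a small multiple of the heat energy at a
  time \<open>N t\<close>, which by subadditivity is absorbed into the left-hand side. This is what allows
  comparing the two energies at a single scale.
\<close>

lemma heat_energy_le_KS:
  obtains \<delta> C' where "0 < \<delta>" "0 < C'"
    "\<And>A t r. A \<in> sets M \<Longrightarrow> emeasure M A < \<infinity> \<Longrightarrow> 0 < t \<Longrightarrow> r = \<delta> * t powr (1 / d\<^sub>W) \<Longrightarrow>
      heat_energy t (indicat_real A) \<le> ennreal (C' * r powr l) * KS_energy M l (indicat_real A) r"
proof -
  obtain N C0 where N: "1 \<le> N" "0 < C0" "\<And>t x y. 0 < t \<Longrightarrow> p t x y \<le>
      C0 * p (real N * t) x y * exp (- (c4 / 2) * (dist x y powr d\<^sub>W / t) powr (1 / (d\<^sub>W - 1)))"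
    by (rule kernel_dilation) (rule that)
  obtain n where n: "N = Suc n" using N(1) by (cases N) auto
  \<comment> \<open>The logarithm makes the tail factor, including the \<open>N\<close> lost to
    subadditivity, at most one half. The bound \<open>\<delta> \<ge> 1\<close> ensures that raising
    to the power \<open>d\<^sub>W / (d\<^sub>W - 1)\<close> does not decrease
    \<open>\<delta>\<close>.\<close>
  define \<delta> where "\<delta> = max 1 (2 / c4 * ln (2 * C0 * real N))"
  have \<delta>: "1 \<le> \<delta>" "0 < \<delta>" by (auto simp: \<delta>_def)
  have small: "C0 * exp (- (c4 / 2) * \<delta>) * real N \<le> 1 / 2"
  proof -
    have pos: "0 < 2 * C0 * real N" using N by simp
    have "ln (2 * C0 * real N) \<le> c4 / 2 * \<delta>"
    proof -
      have "c4 / 2 * (2 / c4 * ln (2 * C0 * real N)) \<le> c4 / 2 * \<delta>"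
        unfolding \<delta>_def using const_pos by (intro mult_left_mono) auto
      then show ?thesis using const_pos by simp
    qed
    then have "2 * C0 * real N \<le> exp (c4 / 2 * \<delta>)" using pos by (metis exp_le_cancel_iff exp_ln)
    then show ?thesis by (simp add: exp_minus field_simps)
  qed
  define C1 where "C1 = c3 * c2 * \<delta> powr d\<^sub>H"
  have C1: "0 < C1" using const_pos \<delta> by (simp add: C1_def)
  show thesis
  proof (rule that[of \<delta> "2 * C1"])
    show "0 < \<delta>" "0 < 2 * C1" using \<delta> C1 by auto
    fix A t r assume A: "A \<in> sets M" "emeasure M A < \<infinity>" and t: "0 < (t::real)" and r: "r = \<delta> * t powr (1 / d\<^sub>W)"
    interpret sub_gaussian_semigroup_set M p d\<^sub>H d\<^sub>W \<kappa> c1 c2 c3 c4 c5 c6 C A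
      by unfold_locales fact+
    have Nt: "0 < real N * t" using N t by simp
    have r0: "0 < r" using \<delta> t by (simp add: r)
    have rH: "t powr (- d\<^sub>H / d\<^sub>W) * r powr d\<^sub>H = \<delta> powr d\<^sub>H"
      using t \<delta> by (simp add: r powr_mult powr_powr powr_minus)
    let ?G = "\<lambda>x y. ennreal (\<bar>ind y - ind x\<bar> / (r powr l * measure M (ball x r))) * indicator (ball x r) y"
    let ?T = "\<lambda>x y. ennreal (p (real N * t) x y * \<bar>ind x - ind y\<bar>)"
    let ?c = "ennreal (C1 * r powr l)" and ?e = "ennreal (C0 * exp (- (c4 / 2) * \<delta>))"
    have mT: "(\<lambda>(x, y). ?T x y) \<in> borel_measurable (M \<Otimes>\<^sub>M M)"
      by (rule heat_energy_integrand_measurable[OF Nt]) simp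
    have mG: "(\<lambda>(x, y). ?G x y) \<in> borel_measurable (M \<Otimes>\<^sub>M M)"
      by (rule KS_integrand_measurable) simp
    have le: "ennreal (p t x y * \<bar>ind x - ind y\<bar>) \<le> ?c * ?G x y + ?e * ?T x y" for x y
    proof (cases "dist x y < r")
      case True
      have V: "0 < measure M (ball x r)"
        using ball_lower[of r x] const_pos r0 by (smt (verit) mult_pos_pos powr_gt_zero)
      have "p t x y \<le> c3 * t powr (- d\<^sub>H / d\<^sub>W)"
        using const_pos by (intro order_trans[OF upper[OF t]] mult_left_le) auto
      moreover have "measure M (ball x r) \<le> c2 * r powr d\<^sub>H" using r0 by (intro ball_upper) simp
      ultimately have "p t x y * measure M (ball x r) \<le> c3 * t powr (- d\<^sub>H / d\<^sub>W) * (c2 * r powr d\<^sub>H)"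
        using kernel_nonneg[OF t] const_pos by (intro mult_mono) auto
      also have "\<dots> = C1" by (simp add: C1_def flip: rH)
      finally have "p t x y \<le> C1 / measure M (ball x r)" using V by (simp add: field_simps)
      then have "p t x y * \<bar>ind x - ind y\<bar> \<le> C1 / measure M (ball x r) * \<bar>ind x - ind y\<bar>"
        by (rule mult_right_mono) simp
      also have "\<dots> = C1 * r powr l * (\<bar>ind y - ind x\<bar> / (r powr l * measure M (ball x r)))"
        using r0 by (simp add: abs_minus_commute)
      finally have "ennreal (p t x y * \<bar>ind x - ind y\<bar>) \<le> ?c * ?G x y"
        using True C1 r0 by (simp flip: ennreal_mult' add: ennreal_leI)
      then show ?thesis by (simp add: add_increasing2)
    next
      case False
      have "\<delta> \<le> (dist x y powr d\<^sub>W / t) powr (1 / (d\<^sub>W - 1))"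
      proof -
        have "\<delta> powr 1 \<le> \<delta> powr (d\<^sub>W * (1 / (d\<^sub>W - 1)))"
          using \<delta> params by (intro powr_mono) (auto simp: field_simps)
        also have "\<dots> = (r powr d\<^sub>W / t) powr (1 / (d\<^sub>W - 1))"
          using \<delta> t params by (simp add: r powr_mult powr_powr)
        also have "\<dots> \<le> (dist x y powr d\<^sub>W / t) powr (1 / (d\<^sub>W - 1))"
          using False r0 t params by (intro powr_mono2 divide_right_mono) auto
        finally show ?thesis using \<delta> by simp
      qed
      then have ex: "exp (- (c4 / 2) * (dist x y powr d\<^sub>W / t) powr (1 / (d\<^sub>W - 1))) \<le> exp (- (c4 / 2) * \<delta>)"
        using const_pos by simp
      have "p t x y \<le> C0 * p (real N * t) x y * exp (- (c4 / 2) * \<delta>)"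
        using N kernel_nonneg[OF Nt, of x y] by (intro order_trans[OF N(3)[OF t]] mult_left_mono ex) auto
      then have "p t x y * \<bar>ind x - ind y\<bar> \<le> C0 * p (real N * t) x y * exp (- (c4 / 2) * \<delta>) * \<bar>ind x - ind y\<bar>"
        by (rule mult_right_mono) simp
      also have "\<dots> = C0 * exp (- (c4 / 2) * \<delta>) * (p (real N * t) x y * \<bar>ind x - ind y\<bar>)"
        by (simp only: mult_ac)
      finally have "ennreal (p t x y * \<bar>ind x - ind y\<bar>) \<le> ennreal (C0 * exp (- (c4 / 2) * \<delta>) * (p (real N * t) x y * \<bar>ind x - ind y\<bar>))"
        by (rule ennreal_leI)
      also have "\<dots> = ?e * ?T x y" using N by (intro ennreal_mult') simp
      finally show ?thesis by (simp add: add_increasing)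
    qed
    have "heat_energy t ind \<le> (\<integral>\<^sup>+x. \<integral>\<^sup>+y. ?c * ?G x y + ?e * ?T x y \<partial>M \<partial>M)"
      unfolding heat_energy_def by (intro nn_integral_mono le)
    also have "\<dots> = ?c * KS_energy M l ind r + ?e * heat_energy (real N * t) ind"
      unfolding KS_energy_def heat_energy_def by (rule double_nn_integral_linear[OF mG mT])
    also have "\<dots> \<le> ?c * KS_energy M l ind r + ?e * (ennreal (real N) * heat_energy t ind)"
      unfolding n by (intro add_left_mono mult_left_mono heat_energy_mult_le t) simp
    also have "?e * (ennreal (real N) * heat_energy t ind) = ennreal (C0 * exp (- (c4 / 2) * \<delta>) * real N) * heat_energy t ind"
      using N by (simp add: ennreal_mult'' flip: mult.assoc)
    also have "?c * KS_energy M l ind r + ennreal (C0 * exp (- (c4 / 2) * \<delta>) * real N) * heat_energy t ind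
        \<le> ?c * KS_energy M l ind r + ennreal (1 / 2) * heat_energy t ind"
      using small by (intro add_left_mono mult_right_mono ennreal_leI) auto
    finally have abs: "heat_energy t ind \<le> ?c * KS_energy M l ind r + ennreal (1 / 2) * heat_energy t ind" .
    show "heat_energy t ind \<le> ennreal (2 * C1 * r powr l) * KS_energy M l ind r"
    proof (cases "KS_energy M l ind r = \<infinity>")
      case True
      then show ?thesis using C1 r0 by (simp add: ennreal_mult_top)
    next
      case False
      then obtain k where k: "KS_energy M l ind r = ennreal k" "0 \<le> k" by (cases "KS_energy M l ind r") auto
      \<comment> \<open>Subtracting half of the heat energy from both sides is legitimate because it
        is finite for a set of finite measure.\<close>
      obtain h where h: "heat_energy t ind = ennreal h" "0 \<le> h"
        using heat_energy_finite[OF t] by (cases "heat_energy t ind") auto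
      have "ennreal (C1 * r powr l * k + 1 / 2 * h) = ?c * ennreal k + ennreal (1 / 2) * ennreal h"
      proof -
        have "ennreal (C1 * r powr l * k) = ?c * ennreal k" by (rule ennreal_mult') (use C1 in simp)
        moreover have "ennreal (1 / 2 * h) = ennreal (1 / 2) * ennreal h" by (rule ennreal_mult') simp
        moreover have "ennreal (C1 * r powr l * k + 1 / 2 * h) = ennreal (C1 * r powr l * k) + ennreal (1 / 2 * h)"
          by (rule ennreal_plus) (use C1 k h in auto)
        ultimately show ?thesis by (simp only:)
      qed
      then have "ennreal h \<le> ennreal (C1 * r powr l * k + 1 / 2 * h)"
        using abs unfolding k h by simp
      then have "h \<le> C1 * r powr l * k + 1 / 2 * h"
        using h k C1 by (subst (asm) ennreal_le_iff) auto
      then have "h \<le> 2 * C1 * r powr l * k" by simp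
      then show ?thesis unfolding k h using C1 k by (simp flip: ennreal_mult add: ennreal_leI)
    qed
  qed
qed

lemma KS_le_heat_energy:
  obtains C' where "0 < C'"
    "\<And>f r t. f \<in> borel_measurable M \<Longrightarrow> 0 < r \<Longrightarrow> r powr d\<^sub>W \<le> t \<Longrightarrow> t \<le> 2 * r powr d\<^sub>W \<Longrightarrow>
      KS_energy M l f r \<le> ennreal (C' * r powr (- l)) * heat_energy t f"
proof -
  define C' where "C' = exp c6 * 2 powr (d\<^sub>H / d\<^sub>W) / (c1 * c5)"
  have C': "0 < C'" using const_pos by (simp add: C'_def)
  show thesis
  proof (rule that[OF C'])
    fix f :: "'a \<Rightarrow> real" and r t :: real
    assume f[measurable]: "f \<in> borel_measurable M" and r: "0 < r" and t1: "r powr d\<^sub>W \<le> t" and t2: "t \<le> 2 * r powr d\<^sub>W"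
    have t: "0 < t" using r t1 by (smt (verit) powr_gt_zero)
    show "KS_energy M l f r \<le> ennreal (C' * r powr (- l)) * heat_energy t f"
      unfolding KS_energy_def heat_energy_def
    proof (rule double_nn_integral_le_cmult[OF heat_energy_integrand_measurable[OF t f]])
      fix x y
      have "\<bar>f y - f x\<bar> / (r powr l * measure M (ball x r)) \<le> C' * r powr (- l) * (p t x y * \<bar>f x - f y\<bar>)"
        if d: "dist x y < r"
      proof -
        have "dist x y powr d\<^sub>W \<le> r powr d\<^sub>W" using d params by (intro powr_mono2) auto
        then have "dist x y powr d\<^sub>W / t \<le> 1" using t1 t by simp
        then have "(dist x y powr d\<^sub>W / t) powr (1 / (d\<^sub>W - 1)) \<le> 1 powr (1 / (d\<^sub>W - 1))"
          using t params by (intro powr_mono2) auto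
        then have e: "exp (- c6) \<le> exp (- c6 * (dist x y powr d\<^sub>W / t) powr (1 / (d\<^sub>W - 1)))"
          using const_pos mult_left_mono[of _ 1 c6] by simp
        have tH: "2 powr (- d\<^sub>H / d\<^sub>W) * r powr (- d\<^sub>H) \<le> t powr (- d\<^sub>H / d\<^sub>W)"
        proof -
          have "(2 * r powr d\<^sub>W) powr (- d\<^sub>H / d\<^sub>W) \<le> t powr (- d\<^sub>H / d\<^sub>W)"
            using t t2 params by (intro powr_mono2') auto
          then show ?thesis using params r by (simp add: powr_mult powr_powr)
        qed
        have "c1 * r powr d\<^sub>H * (c5 * (2 powr (- d\<^sub>H / d\<^sub>W) * r powr (- d\<^sub>H)) * exp (- c6)) \<le>
            measure M (ball x r) * (c5 * t powr (- d\<^sub>H / d\<^sub>W) * exp (- c6 * (dist x y powr d\<^sub>W / t) powr (1 / (d\<^sub>W - 1))))"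
          using const_pos r tH e by (intro mult_mono ball_lower) auto
        also have "\<dots> \<le> measure M (ball x r) * p t x y"
          by (intro mult_left_mono lower t) simp
        finally have Vp: "1 / C' \<le> measure M (ball x r) * p t x y"
          using const_pos r by (simp add: C'_def powr_minus exp_minus field_simps)
        then have V: "measure M (ball x r) \<noteq> 0" using C' by auto
        then have V: "0 < measure M (ball x r)" by (simp add: zero_less_measure_iff)
        have "1 \<le> C' * (measure M (ball x r) * p t x y)" using Vp C' by (simp add: field_simps)
        then have "\<bar>f y - f x\<bar> * 1 \<le> \<bar>f y - f x\<bar> * (C' * (measure M (ball x r) * p t x y))"
          by (intro mult_left_mono) auto
        then show ?thesis
          using V r by (simp add: powr_minus field_simps abs_minus_commute)
      qed
      then show "ennreal (\<bar>f y - f x\<bar> / (r powr l * measure M (ball x r))) * indicator (ball x r) y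
          \<le> ennreal (C' * r powr (- l)) * ennreal (p t x y * \<bar>f x - f y\<bar>)"
        using C' by (cases "dist x y < r") (auto simp flip: ennreal_mult' intro!: ennreal_leI)
    qed
  qed
qed

text \<open>Chains three estimates: from scale \<open>r\<close> to the time
  \<open>real (Suc n) * \<tau>\<close>, down to time \<open>\<tau>\<close>, and back to scale
  \<open>\<rho>\<close>. With the exponent \<open>d\<^sub>W - \<kappa>\<close> all powers of
  \<open>r\<close> and \<open>\<rho>\<close> cancel, which is why the theorem ties
  \<open>\<kappa>\<close> to the critical exponent.\<close>

lemma KS_energy_indicator_comparison:
  obtains \<delta> C' where "0 < \<delta>" "0 < C'"
    "\<And>A r \<rho>. A \<in> sets M \<Longrightarrow> emeasure M A < \<infinity> \<Longrightarrow> 0 < \<rho> \<Longrightarrow> \<rho> \<le> \<delta> * r \<Longrightarrow>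
      KS_energy M (d\<^sub>W - \<kappa>) (indicat_real A) r \<le> ennreal C' * KS_energy M (d\<^sub>W - \<kappa>) (indicat_real A) \<rho>"
proof -
  define l where "l = d\<^sub>W - \<kappa>"
  have l: "0 < l" using params by (simp add: l_def)
  obtain \<delta> C1 where d: "0 < \<delta>" "0 < C1"
    "\<And>A t r. A \<in> sets M \<Longrightarrow> emeasure M A < \<infinity> \<Longrightarrow> 0 < t \<Longrightarrow> r = \<delta> * t powr (1 / d\<^sub>W) \<Longrightarrow>
      heat_energy t (indicat_real A) \<le> ennreal (C1 * r powr l) * KS_energy M l (indicat_real A) r"
    by (rule heat_energy_le_KS) (rule that)
  obtain C2 where C2: "0 < C2"
    "\<And>f r t. f \<in> borel_measurable M \<Longrightarrow> 0 < r \<Longrightarrow> r powr d\<^sub>W \<le> t \<Longrightarrow> t \<le> 2 * r powr d\<^sub>W \<Longrightarrow>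
      KS_energy M l f r \<le> ennreal (C2 * r powr (- l)) * heat_energy t f"
    by (rule KS_le_heat_energy) (rule that)
  obtain C3 where C3: "0 < C3"
    "\<And>A t n. A \<in> sets M \<Longrightarrow> emeasure M A < \<infinity> \<Longrightarrow> 0 < t \<Longrightarrow>
      heat_energy (real (Suc n) * t) (indicat_real A)
      \<le> ennreal (C3 * real (Suc n) powr ((d\<^sub>W - \<kappa>) / d\<^sub>W)) * heat_energy t (indicat_real A)"
    by (rule heat_energy_scaling) (rule that)
  note C3_le = C3(2)[folded l_def]
  define C' where "C' = C2 * C3 * C1 * (2 powr (l / d\<^sub>W) * \<delta> powr l)"
  show thesis
  proof (rule that[OF d(1), of C', folded l_def])
    show "0 < C'" using d C2 C3 by (simp add: C'_def)
    fix A and r \<rho> :: real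
    assume A: "A \<in> sets M" "emeasure M A < \<infinity>" and \<rho>: "0 < \<rho>" "\<rho> \<le> \<delta> * r"
    have r: "0 < r" using \<rho> d(1) by (metis less_le_trans zero_less_mult_pos)
    define \<tau> where "\<tau> = (\<rho> / \<delta>) powr d\<^sub>W"
    have \<tau>: "0 < \<tau>" using \<rho> d by (simp add: \<tau>_def)
    have \<tau>r: "\<tau> \<le> r powr d\<^sub>W"
      unfolding \<tau>_def using \<rho> d params by (intro powr_mono2) (auto simp: field_simps)
    have \<rho>\<tau>: "\<rho> = \<delta> * \<tau> powr (1 / d\<^sub>W)"
      using \<rho> d params by (simp add: \<tau>_def powr_powr)
    define q where "q = r powr d\<^sub>W / \<tau>"
    have q1: "1 \<le> q" using \<tau> \<tau>r by (simp add: q_def)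
    \<comment> \<open>As \<open>q \<ge> 1\<close>, the integer \<open>Suc n\<close> lies between
      \<open>q\<close> and \<open>2 * q\<close>, which matches the range of times in
      \<open>KS_le_heat_energy\<close>.\<close>
    define n where "n = nat \<lfloor>q\<rfloor>"
    have n: "q \<le> real (Suc n)" "real (Suc n) \<le> 2 * q"
      unfolding n_def using q1 by linarith+
    have nt: "r powr d\<^sub>W \<le> real (Suc n) * \<tau>" "real (Suc n) * \<tau> \<le> 2 * r powr d\<^sub>W"
      using n \<tau> by (simp_all add: q_def field_simps del: of_nat_Suc)
    have "KS_energy M l (indicat_real A) r \<le> ennreal (C2 * r powr (- l)) * heat_energy (real (Suc n) * \<tau>) (indicat_real A)"
      by (rule C2(2)[OF _ r nt]) (use A in simp)
    also have "\<dots> \<le> ennreal (C2 * r powr (- l)) * (ennreal (C3 * real (Suc n) powr (l / d\<^sub>W)) * heat_energy \<tau> (indicat_real A))"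
      by (intro mult_left_mono C3_le A \<tau>) simp
    also have "\<dots> \<le> ennreal (C2 * r powr (- l)) * (ennreal (C3 * real (Suc n) powr (l / d\<^sub>W)) *
        (ennreal (C1 * \<rho> powr l) * KS_energy M l (indicat_real A) \<rho>))"
      by (intro mult_left_mono d(3) A \<tau> \<rho>\<tau>) auto
    also have "\<dots> = ennreal (C2 * r powr (- l) * (C3 * real (Suc n) powr (l / d\<^sub>W) * (C1 * \<rho> powr l))) *
        KS_energy M l (indicat_real A) \<rho>"
      using d C2 C3 by (simp add: ennreal_mult mult.assoc del: of_nat_Suc)
    also have "\<dots> \<le> ennreal C' * KS_energy M l (indicat_real A) \<rho>"
    proof (intro mult_right_mono ennreal_leI)
      have "real (Suc n) powr (l / d\<^sub>W) \<le> (2 * q) powr (l / d\<^sub>W)"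
        using n l params by (intro powr_mono2) auto
      also have "\<dots> = 2 powr (l / d\<^sub>W) * (r powr l * \<delta> powr l / \<rho> powr l)"
        using r \<rho> d \<tau> params by (simp add: q_def \<tau>_def powr_mult powr_divide powr_powr)
      finally have "C2 * r powr (- l) * (C3 * real (Suc n) powr (l / d\<^sub>W) * (C1 * \<rho> powr l)) \<le>
          C2 * r powr (- l) * (C3 * (2 powr (l / d\<^sub>W) * (r powr l * \<delta> powr l / \<rho> powr l)) * (C1 * \<rho> powr l))"
        using d C2 C3 by (intro mult_left_mono mult_right_mono) auto
      also have "\<dots> = C'"
        using r \<rho> by (simp add: C'_def powr_minus field_simps)
      finally show "C2 * r powr (- l) * (C3 * real (Suc n) powr (l / d\<^sub>W) * (C1 * \<rho> powr l)) \<le> C'" .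
    qed simp
    finally show "KS_energy M l (indicat_real A) r \<le> ennreal C' * KS_energy M l (indicat_real A) \<rho>" .
  qed
qed

subsection \<open>The coarea formula\<close>

text \<open>Markov's inequality. The level \<open>0\<close> may have infinite measure; later
  arguments discard it as a null set of levels.\<close>

lemma superlevel_finite:
  assumes "integrable M f" "AE x in M. 0 \<le> f x" "0 < t"
  shows "superlevel f t \<in> sets M" "emeasure M (superlevel f t) < \<infinity>"
proof -
  have [measurable]: "f \<in> borel_measurable M" using assms(1) by auto
  have "{x \<in> space M. f x > t} \<in> sets M" by measurable
  then show "superlevel f t \<in> sets M" by (simp add: superlevel_def)
  have "emeasure M (superlevel f t) \<le> emeasure M {x \<in> space M. t \<le> f x}"
    by (intro emeasure_mono) (auto simp: superlevel_def)
  also have "\<dots> \<le> ennreal (1 / t * (\<integral>x. f x \<partial>M))"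
    by (rule integral_Markov_inequality) fact+
  also have "\<dots> < \<infinity>" by simp
  finally show "emeasure M (superlevel f t) < \<infinity>" .
qed

text \<open>Stated for arbitrary measurable maps \<open>g\<close>, \<open>h\<close>,
  \<open>k\<close> from one space, so that it serves every nesting of the integrals over the level
  and the two points.\<close>

lemma coarea_integrand_measurable:
  assumes [measurable]: "f \<in> borel_measurable M"
    and [measurable]: "g \<in> borel_measurable N" "h \<in> N \<rightarrow>\<^sub>M M" "k \<in> N \<rightarrow>\<^sub>M M"
  shows "(\<lambda>z. ennreal (\<bar>indicat_real (superlevel f (g z)) (k z) - indicat_real (superlevel f (g z)) (h z)\<bar>
      / (r powr l * measure M (ball (h z) r))) * indicator (ball (h z) r) (k z) * indicator {0..} (g z))
    \<in> borel_measurable N"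
  unfolding indicator_def superlevel_def mem_ball mem_Collect_eq atLeast_iff by measurable

lemma KS_energy_superlevel:
  "KS_energy M l (indicat_real (superlevel f t)) r * indicator {0..} t =
    (\<integral>\<^sup>+x. \<integral>\<^sup>+y. ennreal (\<bar>indicat_real (superlevel f t) y - indicat_real (superlevel f t) x\<bar>
      / (r powr l * measure M (ball x r))) * indicator (ball x r) y * indicator {0..} t \<partial>M \<partial>M)"
  unfolding KS_energy_def by (cases "0 \<le> t") simp_all

lemma KS_energy_superlevel_measurable:
  assumes f: "f \<in> borel_measurable M"
  shows "(\<lambda>t. KS_energy M l (indicat_real (superlevel f t)) r * indicator {0..} t) \<in> borel_measurable lborel"
  unfolding KS_energy_superlevel
  by (intro borel_measurable_nn_integral, unfold case_prod_beta, intro borel_measurable_nn_integral,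
      unfold case_prod_beta, intro coarea_integrand_measurable f)
     (auto intro!: measurable_compose[OF measurable_fst])

text \<open>The levels separating \<open>a\<close> from \<open>b\<close> form an interval whose
  length is the absolute difference. For \<open>c = 0\<close> both sides vanish, as division by zero
  yields zero.\<close>

lemma coarea_pointwise:
  assumes "0 \<le> (a::real)" "0 \<le> b" "0 \<le> c"
  shows "(\<integral>\<^sup>+t. ennreal (\<bar>of_bool (t < b) - of_bool (t < a)\<bar> / c) * i * indicator {0..} t \<partial>lborel) =
    ennreal (\<bar>b - a\<bar> / c) * i"
proof -
  have "(\<integral>\<^sup>+t. ennreal (\<bar>of_bool (t < b) - of_bool (t < a)\<bar> / c) * i * indicator {0..} t \<partial>lborel) =
      (\<integral>\<^sup>+t. (ennreal (1 / c) * i) * indicator {min a b..<max a b} t \<partial>lborel)"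
    using assms by (intro nn_integral_cong) (auto simp: indicator_def min_def max_def)
  also have "\<dots> = ennreal (1 / c) * i * ennreal (max a b - min a b)"
    by (subst nn_integral_cmult_indicator) auto
  also have "\<dots> = ennreal (1 / c) * ennreal \<bar>b - a\<bar> * i"
    by (simp add: max_def min_def mult_ac abs_if)
  also have "ennreal (1 / c) * ennreal \<bar>b - a\<bar> = ennreal (\<bar>b - a\<bar> / c)"
    using assms by (simp flip: ennreal_mult')
  finally show ?thesis .
qed

text \<open>Write the difference of values as an integral over levels and interchange it by
  Tonelli's theorem, first with \<open>y\<close>, then with \<open>x\<close>. No constant is lost
  here; those of the theorem come from comparing scales.\<close>

lemma coarea:
  assumes f[measurable]: "f \<in> borel_measurable M" and nonneg: "AE x in M. 0 \<le> f x"
  shows "KS_energy M l f r = (\<integral>\<^sup>+t\<in>{0..}. KS_energy M l (indicat_real (superlevel f t)) r \<partial>lborel)"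
proof -
  interpret LM: pair_sigma_finite lborel M
    by (intro pair_sigma_finite.intro sigma_finite_lborel sigma_finite_measure_axioms)
  let ?F = "\<lambda>t x y. ennreal (\<bar>indicat_real (superlevel f t) y - indicat_real (superlevel f t) x\<bar>
      / (r powr l * measure M (ball x r))) * indicator (ball x r) y * indicator {0..} t"
  have pt: "ennreal (\<bar>f y - f x\<bar> / (r powr l * measure M (ball x r))) * indicator (ball x r) y = (\<integral>\<^sup>+t. ?F t x y \<partial>lborel)"
    if "0 \<le> f x" "0 \<le> f y" for x y
    using coarea_pointwise[OF that, of "r powr l * measure M (ball x r)" "indicator (ball x r) y"]
    by (simp add: superlevel_def indicator_def of_bool_def)
  have "KS_energy M l f r = (\<integral>\<^sup>+x. \<integral>\<^sup>+y. \<integral>\<^sup>+t. ?F t x y \<partial>lborel \<partial>M \<partial>M)"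
    unfolding KS_energy_def
  proof (rule nn_integral_cong_AE, use nonneg in eventually_elim)
    case (elim x)
    show ?case
      by (rule nn_integral_cong_AE, use nonneg in eventually_elim) (simp add: elim pt)
  qed
  also have "\<dots> = (\<integral>\<^sup>+x. \<integral>\<^sup>+t. \<integral>\<^sup>+y. ?F t x y \<partial>M \<partial>lborel \<partial>M)"
  proof (rule nn_integral_cong)
    fix x
    have "(\<lambda>(t, y). ?F t x y) \<in> borel_measurable (lborel \<Otimes>\<^sub>M M)"
      unfolding case_prod_beta by (intro coarea_integrand_measurable f) auto
    then show "(\<integral>\<^sup>+y. \<integral>\<^sup>+t. ?F t x y \<partial>lborel \<partial>M) = (\<integral>\<^sup>+t. \<integral>\<^sup>+y. ?F t x y \<partial>M \<partial>lborel)"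
      by (rule LM.Fubini')
  qed
  also have "\<dots> = (\<integral>\<^sup>+t. \<integral>\<^sup>+x. \<integral>\<^sup>+y. ?F t x y \<partial>M \<partial>M \<partial>lborel)"
  proof (rule LM.Fubini')
    show "(\<lambda>(t, x). \<integral>\<^sup>+y. ?F t x y \<partial>M) \<in> borel_measurable (lborel \<Otimes>\<^sub>M M)"
      by (unfold case_prod_beta, intro borel_measurable_nn_integral, unfold case_prod_beta,
          intro coarea_integrand_measurable f)
         (auto intro!: measurable_compose[OF measurable_fst])
  qed
  finally show ?thesis by (simp only: KS_energy_superlevel)
qed

text \<open>Through the coarea formula the comparison of scales passes from sets to functions. The
  first bound is Fatou's lemma along a sequence of scales, the second integrates
  \<open>set_bound\<close> over the levels at each scale, and the third reads off finiteness at
  almost every level from the Fatou estimate.\<close>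

lemma coarea_variation:
  obtains C' where "0 < C'"
    and "\<And>f. integrable M f \<Longrightarrow> AE x in M. 0 \<le> f x \<Longrightarrow>
      (\<integral>\<^sup>+t\<in>{0..}. Liminf (at_right 0) (KS_energy M (d\<^sub>W - \<kappa>) (indicat_real (superlevel f t))) \<partial>lborel)
        \<le> ennreal C' * Liminf (at_right 0) (KS_energy M (d\<^sub>W - \<kappa>) f)"
    and "\<And>f. integrable M f \<Longrightarrow> AE x in M. 0 \<le> f x \<Longrightarrow>
      Limsup (at_right 0) (KS_energy M (d\<^sub>W - \<kappa>) f) \<le>
        ennreal C' * (\<integral>\<^sup>+t\<in>{0..}. Liminf (at_right 0) (KS_energy M (d\<^sub>W - \<kappa>) (indicat_real (superlevel f t))) \<partial>lborel)"
    and "\<And>f. integrable M f \<Longrightarrow> AE x in M. 0 \<le> f x \<Longrightarrow> Limsup (at_right 0) (KS_energy M (d\<^sub>W - \<kappa>) f) < \<infinity> \<Longrightarrow>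
      AE t in lborel. 0 \<le> t \<longrightarrow> indicat_real (superlevel f t) \<in> KS M (d\<^sub>W - \<kappa>)"
proof -
  define l where "l = d\<^sub>W - \<kappa>"
  let ?e = "KS_energy M l"
  let ?V = "\<lambda>h. Liminf (at_right 0) (?e h)"
  obtain \<delta> C' where d: "0 < \<delta>" and C': "0 < C'"
    and "\<And>A r \<rho>. A \<in> sets M \<Longrightarrow> emeasure M A < \<infinity> \<Longrightarrow> 0 < \<rho> \<Longrightarrow> \<rho> \<le> \<delta> * r \<Longrightarrow>
      KS_energy M (d\<^sub>W - \<kappa>) (indicat_real A) r \<le> ennreal C' * KS_energy M (d\<^sub>W - \<kappa>) (indicat_real A) \<rho>"
    by (rule KS_energy_indicator_comparison) (rule that)
  note cmp = this(3)[folded l_def]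
  \<comment> \<open>A value dominated, up to \<open>C'\<close>, by the values at all smaller scales
    is dominated by their lower limit.\<close>
  have to_Liminf: "ennreal (1 / C') * ?e h r \<le> ?V h"
    if "0 < r" "\<And>\<rho>. 0 < \<rho> \<Longrightarrow> \<rho> \<le> \<delta> * r \<Longrightarrow> ?e h r \<le> ennreal C' * ?e h \<rho>" for h r
  proof (rule Liminf_bounded)
    have "\<forall>\<^sub>F \<rho> in at_right 0. \<rho> \<in> {0<..<\<delta> * r}"
      using d that(1) by (intro eventually_at_right_real) simp
    then show "\<forall>\<^sub>F \<rho> in at_right 0. ennreal (1 / C') * ?e h r \<le> ?e h \<rho>"
      by eventually_elim (use that(2) ennreal_le_cmult_iff[OF C'] in simp)
  qed
  have Limsup_le: "Limsup (at_right 0) (?e h) \<le> b" if "\<And>r. 0 < r \<Longrightarrow> ?e h r \<le> b" for h b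
    using that by (intro Limsup_bounded) (auto simp: eventually_at_filter)
  have set_bound: "ennreal (1 / C') * ?e (indicat_real A) r \<le> ?V (indicat_real A)"
    if "A \<in> sets M" "emeasure M A < \<infinity>" "0 < r" for A r
    using that cmp by (intro to_Liminf) auto
  have AE_pos: "AE t in lborel. t \<noteq> (0::real)" by (rule AE_lborel_singleton)
  let ?I = "\<lambda>f::'a \<Rightarrow> real. \<integral>\<^sup>+t\<in>{0..}. ?V (indicat_real (superlevel f t)) \<partial>lborel"
  let ?G = "\<lambda>f r t. ?e (indicat_real (superlevel f t)) r * indicator {0..} t"
  let ?s = "\<lambda>n. 1 / real (Suc n)"
  have cmp_f: "?e f r \<le> ennreal C' * ?e f \<rho>"
    if f: "integrable M f" "AE x in M. 0 \<le> f x" and \<rho>: "0 < \<rho>" "\<rho> \<le> \<delta> * r" for f r \<rho>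
  proof -
    have m: "f \<in> borel_measurable M" using f(1) by auto
    have "?e f r = (\<integral>\<^sup>+t. ?G f r t \<partial>lborel)" by (rule coarea[OF m f(2)])
    also have "\<dots> \<le> (\<integral>\<^sup>+t. ennreal C' * ?G f \<rho> t \<partial>lborel)"
    proof (rule nn_integral_mono_AE, use AE_pos in eventually_elim)
      case (elim t)
      then show "?G f r t \<le> ennreal C' * ?G f \<rho> t"
        using cmp[OF superlevel_finite[OF f, of t] \<rho>] by (cases "0 \<le> t") auto
    qed
    also have "\<dots> = ennreal C' * ?e f \<rho>"
      unfolding coarea[OF m f(2), of l \<rho>] by (rule nn_integral_cmult[OF KS_energy_superlevel_measurable[OF m]])
    finally show ?thesis .
  qed
  have Fatou: "(\<integral>\<^sup>+t. liminf (\<lambda>n. ?G f (?s n) t) \<partial>lborel) \<le> ennreal C' * ?V f"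
    if f: "integrable M f" "AE x in M. 0 \<le> f x" for f
  proof -
    have m: "f \<in> borel_measurable M" using f(1) by auto
    have "(\<integral>\<^sup>+t. liminf (\<lambda>n. ?G f (?s n) t) \<partial>lborel) \<le> liminf (\<lambda>n. \<integral>\<^sup>+t. ?G f (?s n) t \<partial>lborel)"
      by (intro nn_integral_liminf KS_energy_superlevel_measurable[OF m])
    also have "\<dots> = liminf (\<lambda>n. ?e f (?s n))" unfolding coarea[OF m f(2)] ..
    \<comment> \<open>The lower limit along the sequence may exceed the one over all scales; the
      comparison of scales for \<open>f\<close> itself bounds it by \<open>?V f\<close>.\<close>
    also have "\<dots> \<le> ennreal C' * ?V f"
    proof (rule order_trans[OF Liminf_le_Limsup Limsup_bounded])
      have "?e f (?s n) \<le> ennreal C' * ?V f" for n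
        unfolding ennreal_le_cmult_iff[OF C'] using cmp_f[OF f] by (intro to_Liminf) auto
      then show "\<forall>\<^sub>F n in sequentially. ?e f (?s n) \<le> ennreal C' * ?V f" by simp
    qed simp
    finally show ?thesis .
  qed
  have V_le: "?V (indicat_real (superlevel f t)) * indicator {0..} t \<le> liminf (\<lambda>n. ?G f (?s n) t)" for f t
    using Liminf_le_liminf_subseq[OF filterlim_inverse_Suc_at_right, of "?e (indicat_real (superlevel f t))"]
    by (cases "0 \<le> t") (auto simp del: of_nat_Suc)
  show thesis
  proof (rule that[OF C', folded l_def])
    fix f :: "'a \<Rightarrow> real" assume f: "integrable M f" "AE x in M. 0 \<le> f x"
    have m: "f \<in> borel_measurable M" using f(1) by auto
    show "?I f \<le> ennreal C' * ?V f"
      by (intro order_trans[OF nn_integral_mono[OF V_le] Fatou[OF f]])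
    show "Limsup (at_right 0) (?e f) \<le> ennreal C' * ?I f"
    proof (rule Limsup_le)
      fix r :: real assume r: "0 < r"
      have "ennreal (1 / C') * ?e f r = (\<integral>\<^sup>+t. ennreal (1 / C') * ?G f r t \<partial>lborel)"
        unfolding coarea[OF m f(2), of l r] by (rule nn_integral_cmult[OF KS_energy_superlevel_measurable[OF m], symmetric])
      also have "\<dots> \<le> ?I f"
      proof (rule nn_integral_mono_AE, use AE_pos in eventually_elim)
        case (elim t)
        then show "ennreal (1 / C') * ?G f r t \<le> ?V (indicat_real (superlevel f t)) * indicator {0..} t"
          using set_bound[OF superlevel_finite[OF f, of t] r] by (cases "0 \<le> t") auto
      qed
      finally show "?e f r \<le> ennreal C' * ?I f" unfolding ennreal_le_cmult_iff[OF C'] .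
    qed
    assume fin: "Limsup (at_right 0) (?e f) < \<infinity>"
    have "?V f < \<infinity>" using fin by (rule le_less_trans[OF Liminf_le_Limsup, rotated]) simp
    \<comment> \<open>The lower limit along a sequence is measurable in \<open>t\<close>, so its
      finite integral makes it finite almost everywhere; \<open>V_le\<close> transfers this to
      \<open>?V\<close>.\<close>
    then have "(\<integral>\<^sup>+t. liminf (\<lambda>n. ?G f (?s n) t) \<partial>lborel) < \<infinity>"
      by (intro le_less_trans[OF Fatou[OF f]]) (simp add: ennreal_mult_less_top)
    then have "AE t in lborel. liminf (\<lambda>n. ?G f (?s n) t) \<noteq> \<infinity>"
      by (intro nn_integral_noteq_infinite borel_measurable_liminf KS_energy_superlevel_measurable[OF m]) auto
    then show "AE t in lborel. 0 \<le> t \<longrightarrow> indicat_real (superlevel f t) \<in> KS M l"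
      using AE_pos
    proof eventually_elim
      case (elim t)
      show ?case
      proof
        assume "0 \<le> t"
        with elim have t: "0 < t" by simp
        note A = superlevel_finite[OF f t]
        have "?V (indicat_real (superlevel f t)) < \<infinity>"
          using V_le[of f t] t elim(1) by (auto simp: less_top intro: le_less_trans)
        then have "ennreal C' * ?V (indicat_real (superlevel f t)) < \<infinity>" by (simp add: ennreal_mult_less_top)
        moreover have "Limsup (at_right 0) (?e (indicat_real (superlevel f t))) \<le> ennreal C' * ?V (indicat_real (superlevel f t))"
          using set_bound[OF A] by (intro Limsup_le) (simp add: ennreal_le_cmult_iff[OF C'])
        ultimately have "Limsup (at_right 0) (?e (indicat_real (superlevel f t))) < \<infinity>" by (rule le_less_trans[rotated])
        then show "indicat_real (superlevel f t) \<in> KS M l"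
          using A by (simp add: KS_def less_top[symmetric])
      qed
    qed
  qed
qed

end

section \<open>Instantiation for sub-Gaussian Dirichlet spaces and the theorem\<close>

context sub_gaussian_dirichlet_space
begin

lemma ex_sub_gaussian_semigroup:
  assumes wBE: "wBE M p d\<^sub>W \<kappa>"
  shows "\<exists>c1 c2 c3 c4 c5 c6 C. sub_gaussian_semigroup M p d\<^sub>H d\<^sub>W \<kappa> c1 c2 c3 c4 c5 c6 C"
proof -
  obtain c1 c2 where c12: "0 < c1" "0 < c2"
    "\<And>x r. 0 \<le> r \<Longrightarrow> c1 * r powr d\<^sub>H \<le> measure M (ball x r)"
    "\<And>x r. 0 \<le> r \<Longrightarrow> measure M (ball x r) \<le> c2 * r powr d\<^sub>H"
    by (rule ahlfors_measure) (rule that)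
  obtain c3 c4 c5 c6 where c: "0 < c3" "0 < c4" "0 < c5" "0 < c6" and b: "\<forall>t>0. \<forall>x y.
    c5 * t powr (- d\<^sub>H / d\<^sub>W) * exp (- c6 * (dist x y powr d\<^sub>W / t) powr (1 / (d\<^sub>W - 1))) \<le> p t x y \<and>
    p t x y \<le> c3 * t powr (- d\<^sub>H / d\<^sub>W) * exp (- c4 * (dist x y powr d\<^sub>W / t) powr (1 / (d\<^sub>W - 1)))"
    using kernel_bounds by blast
  obtain C where C: "0 < C"
    "\<And>t g x y. 0 < t \<Longrightarrow> g \<in> borel_measurable M \<Longrightarrow> (\<And>z. \<bar>g z\<bar> \<le> 1) \<Longrightarrow>
      \<bar>heat_op M p t g x - heat_op M p t g y\<bar> \<le> C * (dist x y powr \<kappa> / t powr (\<kappa> / d\<^sub>W))"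
    using heat_op_holder[OF wBE] by blast
  have "sub_gaussian_semigroup M p d\<^sub>H d\<^sub>W \<kappa> c1 c2 c3 c4 c5 c6 C"
  proof (rule sub_gaussian_semigroup.intro[OF sigma_finite_measure_axioms sub_gaussian_semigroup_axioms.intro])
    show "sets M = sets borel" by (rule sets_M)
    show "(\<lambda>(x, y). dist x y) \<in> borel_measurable (M \<Otimes>\<^sub>M M)"
      by (intro continuous_measurable_pair) (auto simp: case_prod_beta intro!: continuous_intros)
    show "symmetric_markov_kernel M (p t)" if "0 < t" for t
      by (rule symmetric_markov_kernel_heat[OF wBE that])
    show "0 < d\<^sub>H" using ahlfors by (simp add: ahlfors_regular_def)
    show "2 < d\<^sub>W" by (rule walk_dim)
    show "0 < \<kappa>" "\<kappa> < d\<^sub>W" using wBE by (auto simp: wBE_def)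
    show "AE x in M. heat_op M p (s + t) (indicat_real A) x = heat_op M p s (heat_op M p t (indicat_real A)) x"
      if "A \<in> sets M" "emeasure M A < \<infinity>" "0 < s" "0 < t" for A s t
      using that by (intro heat_op_semigroup indicator_L2)
  qed (use c12 c b C in auto)
  then show ?thesis by blast
qed

end

theorem theorem4p15:
  fixes M :: "'a::metric_space measure"
    and E :: "('a \<Rightarrow> real) \<Rightarrow> ('a \<Rightarrow> real) \<Rightarrow> real"
    and F :: "('a \<Rightarrow> real) set"
    and p :: "real \<Rightarrow> 'a \<Rightarrow> 'a \<Rightarrow> real"
    and d\<^sub>H d\<^sub>W \<kappa> :: real
  assumes "sub_gaussian_dirichlet_space M E F p d\<^sub>H d\<^sub>W"
    and "wBE M p d\<^sub>W \<kappa>"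
    and "ereal \<kappa> = ereal d\<^sub>W - crit_exp M"
  shows "\<exists>C\<^sub>1>0. \<exists>C\<^sub>2>0. \<forall>f :: 'a \<Rightarrow> real. integrable M f \<and> (AE x in M. 0 \<le> f x) \<longrightarrow>
      ennreal C\<^sub>1 * (\<integral>\<^sup>+t\<in>{0..}. Var M (indicat_real (superlevel f t)) \<partial>lborel) \<le> Var M f \<and>
      Var M f \<le> ennreal C\<^sub>2 * (\<integral>\<^sup>+t\<in>{0..}. Var M (indicat_real (superlevel f t)) \<partial>lborel) \<and>
      (f \<in> BV M \<longrightarrow> (AE t in lborel. 0 \<le> t \<longrightarrow> indicat_real (superlevel f t) \<in> BV M)) \<and>
      ((AE t in lborel. 0 \<le> t \<longrightarrow> indicat_real (superlevel f t) \<in> BV M) \<and>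
         (\<integral>\<^sup>+t\<in>{0..}. Var M (indicat_real (superlevel f t)) \<partial>lborel) < \<infinity> \<longrightarrow> f \<in> BV M)"
proof -
  interpret sub_gaussian_dirichlet_space M E F p d\<^sub>H d\<^sub>W by fact
  obtain c1 c2 c3 c4 c5 c6 C where "sub_gaussian_semigroup M p d\<^sub>H d\<^sub>W \<kappa> c1 c2 c3 c4 c5 c6 C"
    using ex_sub_gaussian_semigroup[OF assms(2)] by blast
  then interpret S: sub_gaussian_semigroup M p d\<^sub>H d\<^sub>W \<kappa> c1 c2 c3 c4 c5 c6 C .
  \<comment> \<open>A real \<open>\<kappa>\<close> rules out an infinite critical exponent, so the
    conversion to a real number is faithful.\<close>
  have crit: "real_of_ereal (crit_exp M) = d\<^sub>W - \<kappa>"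
    using assms(3) by (cases "crit_exp M") auto
  have Var: "Var M h = Liminf (at_right 0) (KS_energy M (d\<^sub>W - \<kappa>) h)" for h
    by (simp add: Var_def crit)
  have BV: "BV M = KS M (d\<^sub>W - \<kappa>)" by (simp add: BV_def crit)
  obtain C' where C': "0 < C'"
    and 1: "\<And>f. integrable M f \<Longrightarrow> AE x in M. 0 \<le> f x \<Longrightarrow>
      (\<integral>\<^sup>+t\<in>{0..}. Var M (indicat_real (superlevel f t)) \<partial>lborel) \<le> ennreal C' * Var M f"
    and 2: "\<And>f. integrable M f \<Longrightarrow> AE x in M. 0 \<le> f x \<Longrightarrow>
      Limsup (at_right 0) (KS_energy M (d\<^sub>W - \<kappa>) f) \<le>
        ennreal C' * (\<integral>\<^sup>+t\<in>{0..}. Var M (indicat_real (superlevel f t)) \<partial>lborel)"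
    and 3: "\<And>f. integrable M f \<Longrightarrow> AE x in M. 0 \<le> f x \<Longrightarrow> Limsup (at_right 0) (KS_energy M (d\<^sub>W - \<kappa>) f) < \<infinity> \<Longrightarrow>
      AE t in lborel. 0 \<le> t \<longrightarrow> indicat_real (superlevel f t) \<in> BV M"
    by (rule S.coarea_variation[folded Var BV]) (rule that)
  show ?thesis
  proof (rule exI[of _ "1 / C'"], rule conjI, use C' in simp, rule exI[of _ C'], intro conjI allI impI)
    fix f :: "'a \<Rightarrow> real"
    assume "integrable M f \<and> (AE x in M. 0 \<le> f x)"
    then have f: "integrable M f" "AE x in M. 0 \<le> f x" by auto
    let ?I = "\<integral>\<^sup>+t\<in>{0..}. Var M (indicat_real (superlevel f t)) \<partial>lborel"
    show "ennreal (1 / C') * ?I \<le> Var M f"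
      using 1[OF f] by (simp add: ennreal_le_cmult_iff[OF C'])
    have "Var M f \<le> Limsup (at_right 0) (KS_energy M (d\<^sub>W - \<kappa>) f)"
      unfolding Var by (rule Liminf_le_Limsup) simp
    then show "Var M f \<le> ennreal C' * ?I" using 2[OF f] by (rule order_trans)
    show "AE t in lborel. 0 \<le> t \<longrightarrow> indicat_real (superlevel f t) \<in> BV M" if "f \<in> BV M"
      using that f unfolding BV KS_def by (intro 3[OF f, unfolded BV KS_def]) auto
    \<comment> \<open>The estimate \<open>2\<close> bounds the upper limit of the energies, whose
      finiteness is what membership in \<open>BV M\<close> asks.\<close>
    show "f \<in> BV M" if "(AE t in lborel. 0 \<le> t \<longrightarrow> indicat_real (superlevel f t) \<in> BV M) \<and> ?I < \<infinity>"
    proof -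
      have "ennreal C' * ?I < \<infinity>" using that by (simp add: ennreal_mult_less_top)
      then have "Limsup (at_right 0) (KS_energy M (d\<^sub>W - \<kappa>) f) < \<infinity>" by (rule le_less_trans[OF 2[OF f]])
      then show ?thesis unfolding BV KS_def using f by simp
    qed
  qed (use C' in simp)
qed

end
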